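(* Let $\tau>\pi/2$ and let $\widetilde{C}\subset S^2$ be a spherical convex body of constant width $\tau$. Then there exists a sequence $\{\widetilde{C}_i\}_{i=1}^\infty$ of spherical convex bodies in $S^2$ of constant width $\tau$, each of whose boundaries consists only of arcs of circles of radius $\tau-\frac{\pi}{2}$ and great circle segments, such that $\lim_{i\to\infty}\widetilde{C}_i=\widetilde{C}$ with respect to the Hausdorff distance.
   Context: $S^2$ is the unit sphere in $\mathbb{R}^3$ and $|\widetilde P\widetilde Q|=\arccos(\widetilde P\cdot\widetilde Q)$ is the spherical distance; the Hausdorff distance is taken with respect to it. For $\widetilde P\in S^2$ let $H(\widetilde P)=\{\widetilde Q\in S^2\mid\widetilde P\cdot\widetilde Q\ge0\}$ be the closed hemisphere centered at $\widetilde P$. A set $\widetilde X\subset S^2$ is hemispherical if $H(\widetilde P)\cap\widetilde X=\emptyset$ for some $\widetilde P\in S^2$. For $\widetilde P\ne-\widetilde Q$, the arc $\widetilde P\widetilde Q$ is the shorter great circle arc joining them. A hemispherical set is spherical convex if it contains the arc $\widetilde P\widetilde Q$ for any two of its points $\widetilde P,\widetilde Q$; a spherical convex body is a closed spherical convex set with an interior point. A hemisphere $H(\widetilde Q)$ supports $\widetilde C$ at $\widetilde P\in\partial\widetilde C$ (and is a supporting hemisphere of $\widetilde C$) if $\widetilde C\subset H(\widetilde Q)$ and $\widetilde P\in\widetilde C\cap\partial H(\widetilde Q)$. If $\widetilde P\ne\pm\widetilde Q$, the lune $H(\widetilde P)\cap H(\widetilde Q)$ has thickness $\Delta(H(\widetilde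 P)\cap H(\widetilde Q))=\pi-|\widetilde P\widetilde Q|$. For a supporting hemisphere $H(\widetilde P)$ of $\widetilde C$, the width is $\mathrm{width}_{H(\widetilde P)}(\widetilde C)=\min\{\Delta(H(\widetilde P)\cap H(\widetilde Q))\mid H(\widetilde Q)\text{ supports }\widetilde C\}$ (minimum over $\widetilde Q\neq\pm\widetilde P$). $\widetilde C$ is of constant width $\tau$ if $\mathrm{width}_{H(\widetilde P)}(\widetilde C)=\tau$ for all supporting hemispheres $H(\widetilde P)$. A circle of radius $\rho$ on $S^2$ is a set $\{\widetilde Q\in S^2\mid|\widetilde P\widetilde Q|=\rho\}$; "the boundary consists only of" certain arcs means that it is a finite union of such arcs. *)

theory Defs
  imports "HOL-Analysis.Analysis"
begin

abbreviation S2 :: "(real^3) set" where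
  "S2 \<equiv> sphere 0 1"

definition sdist :: "real^3 \<Rightarrow> real^3 \<Rightarrow> real" where
  "sdist P Q = arccos (P \<bullet> Q)"

(* Interior, boundary and closedness are always those of the topological space S2, not of the
   ambient space, in which subsets of S2 have empty interior. *)

abbreviation sinterior :: "(real^3) set \<Rightarrow> (real^3) set" where
  "sinterior X \<equiv> (top_of_set S2) interior_of X"

abbreviation sboundary :: "(real^3) set \<Rightarrow> (real^3) set" where
  "sboundary X \<equiv> (top_of_set S2) frontier_of X"

definition hemisphere :: "real^3 \<Rightarrow> (real^3) set" where
  "hemisphere P = {Q \<in> S2. P \<bullet> Q \<ge> 0}"

definition hemispherical :: "(real^3) set \<Rightarrow> bool" where
  "hemispherical X \<longleftrightarrow> X \<subseteq> S2 \<and> (\<exists>P\<in>S2. hemisphere P \<inter> X = {})"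

(* For P \<noteq> -Q on the sphere, the shorter great circle arc from P to Q is the part of the
   sphere in the convex cone generated by P and Q. *)
definition gc_arc :: "real^3 \<Rightarrow> real^3 \<Rightarrow> (real^3) set" where
  "gc_arc P Q = {R \<in> S2. \<exists>a\<ge>0. \<exists>b\<ge>0. R = a *\<^sub>R P + b *\<^sub>R Q}"

(* Two points of a hemispherical set are never antipodal, so gc_arc is applied only where it
   is the shorter arc. *)
definition spherical_convex :: "(real^3) set \<Rightarrow> bool" where
  "spherical_convex X \<longleftrightarrow> hemispherical X \<and> (\<forall>P\<in>X. \<forall>Q\<in>X. gc_arc P Q \<subseteq> X)"

definition spherical_convex_body :: "(real^3) set \<Rightarrow> bool" where
  "spherical_convex_body C \<longleftrightarrow>
     closedin (top_of_set S2) C \<and> spherical_convex C \<and> sinterior C \<noteq> {}"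

(* Hemispheres and lunes are represented by the centers of the hemispheres. *)

definition supports_at :: "real^3 \<Rightarrow> (real^3) set \<Rightarrow> real^3 \<Rightarrow> bool" where
  "supports_at Q C P \<longleftrightarrow>
     Q \<in> S2 \<and> P \<in> sboundary C \<and> C \<subseteq> hemisphere Q \<and> P \<in> C \<inter> sboundary (hemisphere Q)"

definition supporting :: "real^3 \<Rightarrow> (real^3) set \<Rightarrow> bool" where
  "supporting Q C \<longleftrightarrow> (\<exists>P. supports_at Q C P)"

definition lune_thickness :: "real^3 \<Rightarrow> real^3 \<Rightarrow> real" where
  "lune_thickness P Q = pi - sdist P Q"

(* LEAST on the reals is the minimum, i.e. it is required to be attained. *)
definition width :: "real^3 \<Rightarrow> (real^3) set \<Rightarrow> real" where
  "width P C =
     (LEAST t. \<exists>Q. supporting Q C \<and> Q \<noteq> P \<and> Q \<noteq> - P \<and> t = lune_thickness P Q)"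

definition constant_width :: "(real^3) set \<Rightarrow> real \<Rightarrow> bool" where
  "constant_width C \<tau> \<longleftrightarrow> (\<forall>P. supporting P C \<longrightarrow> width P C = \<tau>)"

definition scircle :: "real^3 \<Rightarrow> real \<Rightarrow> (real^3) set" where
  "scircle P \<rho> = {Q \<in> S2. sdist P Q = \<rho>}"

definition circle_arc :: "real \<Rightarrow> (real^3) set \<Rightarrow> bool" where
  "circle_arc \<rho> A \<longleftrightarrow> (\<exists>P\<in>S2. \<exists>g. arc g \<and> path_image g = A \<and> A \<subseteq> scircle P \<rho>)"

definition gc_segment :: "(real^3) set \<Rightarrow> bool" where
  "gc_segment A \<longleftrightarrow> (\<exists>P\<in>S2. \<exists>Q\<in>S2. P \<noteq> Q \<and> P \<noteq> - Q \<and> A = gc_arc P Q)"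

definition boundary_of_arcs :: "real \<Rightarrow> (real^3) set \<Rightarrow> bool" where
  "boundary_of_arcs \<rho> C \<longleftrightarrow>
     (\<exists>F. finite F \<and> (\<forall>A\<in>F. circle_arc \<rho> A \<or> gc_segment A) \<and> sboundary C = \<Union>F)"

(* Meaningful for nonempty subsets of S2, where all values of sdist lie between 0 and pi, so
   that the suprema and infima are genuine. *)
definition hausdorff_sdist :: "(real^3) set \<Rightarrow> (real^3) set \<Rightarrow> real" where
  "hausdorff_sdist X Y =
     max (SUP P\<in>X. INF Q\<in>Y. sdist P Q) (SUP Q\<in>Y. INF P\<in>X. sdist P Q)"

end

theory Submission
  imports Defs
begin

text \<open>
  Put \<open>\<delta> = \<pi> - \<tau> < \<pi>/2\<close>, \<open>c = cos \<delta> > 0\<close> and \<open>s = sin \<delta>\<close>. Hemispheres containing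
  \<open>C\<close> correspond to points of the polar \<open>K = C\<degree>\<close>, and constant width \<open>\<tau>\<close> of \<open>C\<close> says that
  \<open>K\<close> has diameter \<open>\<delta>\<close> and is diametrically complete: \<open>K\<close> is the intersection of all balls of
  radius \<open>\<delta>\<close> centred in \<open>K\<close>. A fine finite net of \<open>K\<close> is enlarged by adding, one at a time,
  vertices of the ball polygon it determines. Each new point is at distance \<open>\<delta>\<close> from at least
  two old ones, while \<open>n\<close> points of diameter \<open>\<delta>\<close> have at most \<open>n\<close> diameters
  (Hopf-Pannwitz), so this stops, and a ball polygon whose vertices are all among its centres is
  complete. The polars of these Reuleaux polygons have constant width \<open>\<tau>\<close>. Their boundaries
  consist of circular arcs of radius \<open>\<pi>/2 - \<delta>\<close> about the centres and of great circle segments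
  polar to the vertices; they converge to \<open>C\<close> because a finer net squeezes the polygons towards
  \<open>K\<close>.
\<close>

section \<open>Spherical caps and supporting hemispheres\<close>

text \<open>Distances occur only as inner products of unit vectors: a ball becomes a linear
  inequality, points between others are positive combinations normalised by \<open>sgn\<close>, and
  strict convexity of balls is the strict triangle inequality for norms. The hypothesis \<tau> >
  \<pi>/2 enters as c > 0, since these norm estimates are multiplied by c. Three obstacles shape the
  argument. Constant width speaks only of hemispheres that touch C, so the diameter bound and
  completeness must be carried from their centres to all of K by looking at extremal points.
  Completing a net adds centres that nothing keeps inside K, so the comparison with K and C may use
  only that the net survives among the centres. Finally, pieces of the boundary can shrink to single
  points, whereas arcs and segments are nondegenerate; such points have to be found on other pieces,
  which works because the boundary has no isolated point.\<close>

text \<open>The intersection of all closed balls of radius \<open>arccos c\<close> centred in \<open>X\<close>; for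
  \<open>c = 0\<close> this is the polar of \<open>X\<close>.\<close>

definition caps :: "real \<Rightarrow> (real^3) set \<Rightarrow> (real^3) set" where
  "caps c X = {Q \<in> S2. \<forall>P\<in>X. c \<le> P \<bullet> Q}"

lemma capsD: "Q \<in> caps c X \<Longrightarrow> norm Q = 1" "Q \<in> caps c X \<Longrightarrow> P \<in> X \<Longrightarrow> c \<le> P \<bullet> Q"
  by (auto simp: caps_def)

lemma caps_subset: "caps c X \<subseteq> S2"
  by (auto simp: caps_def)

lemma caps_antimono: "X \<subseteq> Y \<Longrightarrow> caps c Y \<subseteq> caps c X"
  by (auto simp: caps_def)

lemma compact_caps: "compact (caps c X)"
proof -
  have "caps c X = S2 \<inter> (\<Inter>P\<in>X. {Q. P \<bullet> Q \<ge> c})"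
    by (auto simp: caps_def)
  moreover have "closed (\<Inter>P\<in>X. {Q. P \<bullet> Q \<ge> c})"
    by (intro closed_INT ballI closed_halfspace_ge)
  ultimately show ?thesis by (simp add: compact_Int_closed)
qed

lemma inner_le_1: "norm x = 1 \<Longrightarrow> norm y = 1 \<Longrightarrow> x \<bullet> y \<le> 1" for x y :: "'a::real_inner"
  by (metis norm_cauchy_schwarz mult_1)

lemma inner_eq_1D: "norm x = 1 \<Longrightarrow> norm y = 1 \<Longrightarrow> x \<bullet> y = 1 \<Longrightarrow> x = y" for x y :: "'a::real_inner"
  by (metis norm_cauchy_schwarz_eq mult_1 scaleR_one)

lemma inner_ge_minus_1: "norm x = 1 \<Longrightarrow> norm y = 1 \<Longrightarrow> -1 \<le> x \<bullet> y" for x y :: "'a::real_inner"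
  using inner_le_1[of "-x" y] by simp

lemma inner_eq_minus_1D: "norm x = 1 \<Longrightarrow> norm y = 1 \<Longrightarrow> x \<bullet> y = -1 \<Longrightarrow> x = -y" for x y :: "'a::real_inner"
  using inner_eq_1D[of x "-y"] by simp

lemma inner_sgn: "y \<bullet> sgn p = (y \<bullet> p) / norm p" for p y :: "'a::real_inner"
  by (simp add: sgn_div_norm field_simps)

lemma sgn_in_caps:
  assumes "p \<noteq> 0" "\<And>P. P \<in> X \<Longrightarrow> c * norm p \<le> P \<bullet> p"
  shows "sgn p \<in> caps c X"
  using assms by (auto simp: caps_def norm_sgn inner_sgn field_simps)

lemma sgn_in_polar:
  assumes "p \<noteq> 0" "\<And>P. P \<in> X \<Longrightarrow> 0 \<le> P \<bullet> p"
  shows "sgn p \<in> caps 0 X"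
  using assms sgn_in_caps[of p X 0] by simp

text \<open>Rotating x by a small angle t away from Q along their great circle gives a point whose
  inner product with Q is -sin t < 0, so X omits points arbitrarily close to x.\<close>

lemma sboundaryI:
  assumes X: "X \<subseteq> hemisphere Q" "x \<in> X" and Q: "norm Q = 1" "Q \<bullet> x = 0"
  shows "x \<in> sboundary X"
proof -
  have x: "norm x = 1" using X by (auto simp: hemisphere_def)
  have XS: "X \<subseteq> S2" using X by (auto simp: hemisphere_def)
  have cl: "x \<in> (top_of_set S2) closure_of X"
    using XS X(2) closure_of_subset[of X "top_of_set S2"] by auto
  have "x \<notin> sinterior X"
  proof
    assume "x \<in> sinterior X"
    then obtain T where T: "open T" "x \<in> T" "S2 \<inter> T \<subseteq> X"
      by (auto simp: interior_of_def openin_open)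
    define f where "f t = cos t *\<^sub>R x - sin t *\<^sub>R Q" for t :: real
    have "continuous (at 0) f"
      unfolding f_def by (intro continuous_intros)
    then have "(f \<longlongrightarrow> x) (at 0)" by (simp add: continuous_within f_def)
    then have "eventually (\<lambda>t. f t \<in> T) (at 0)"
      using T topological_tendstoD by blast
    then obtain d where d: "d > 0" "\<And>t. t \<noteq> 0 \<Longrightarrow> \<bar>t\<bar> < d \<Longrightarrow> f t \<in> T"
      unfolding eventually_at by (auto simp: dist_real_def)
    define t where "t = min (d/2) 1"
    have t: "0 < t" "t < d" "t < pi" using d pi_gt3 by (auto simp: t_def)
    have "norm (f t) ^ 2 = 1"
    proof -
      have "x \<bullet> x = 1" "Q \<bullet> Q = 1" "x \<bullet> Q = 0"
        using x Q by (auto simp: dot_square_norm inner_commute)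
      then show ?thesis
        using Q unfolding power2_norm_eq_inner f_def
        by (simp add: inner_diff_left inner_diff_right flip: power2_eq_square)
    qed
    then have "norm (f t) = 1" by (simp add: power2_eq_1_iff) (metis norm_ge_zero not_one_le_zero neg_0_le_iff_le)
    then have "f t \<in> X" using T d t by auto
    then have "0 \<le> Q \<bullet> f t" using X by (auto simp: hemisphere_def)
    moreover have "Q \<bullet> f t = - sin t"
      using Q by (simp add: f_def inner_diff_right dot_square_norm)
    ultimately show False using sin_gt_zero[of t] t by simp
  qed
  then show ?thesis using cl by (simp add: frontier_of_def)
qed

lemma closedin_S2_iff: "closedin (top_of_set S2) X \<longleftrightarrow> compact X \<and> X \<subseteq> S2"
  by (metis closedin_closed_eq closed_sphere compact_Int_closed compact_imp_closed compact_sphere inf.absorb_iff2 closedin_compact closedin_imp_subset closed_subset)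

text \<open>Trades the topology of S2 for inner products. Both boundary conditions in the definition
  of support follow from \<open>sboundaryI\<close> once a contact point with P \<bullet> x = 0 is
  known.\<close>

lemma supporting_iff:
  assumes "compact C" "C \<subseteq> S2"
  shows "supporting P C \<longleftrightarrow> P \<in> caps 0 C \<and> (\<exists>x\<in>C. P \<bullet> x = 0)"
proof
  assume "supporting P C"
  then obtain x where x: "norm P = 1" "C \<subseteq> hemisphere P" "x \<in> C" "x \<in> sboundary (hemisphere P)"
    by (auto simp: supporting_def supports_at_def)
  have "\<not> P \<bullet> x > 0"
  proof
    assume "P \<bullet> x > 0"
    then have "x \<in> S2 \<inter> {y. P \<bullet> y > 0}" using assms x by auto
    moreover have "openin (top_of_set S2) (S2 \<inter> {y. P \<bullet> y > 0})"
      by (simp add: openin_open_Int open_halfspace_gt)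
    ultimately have "x \<in> sinterior (hemisphere P)"
      unfolding interior_of_def hemisphere_def by fastforce
    then show False using x by (simp add: frontier_of_def)
  qed
  moreover have "P \<bullet> x \<ge> 0" using x by (auto simp: hemisphere_def)
  ultimately show "P \<in> caps 0 C \<and> (\<exists>x\<in>C. P \<bullet> x = 0)"
    using x by (auto simp: hemisphere_def caps_def inner_commute)
next
  assume "P \<in> caps 0 C \<and> (\<exists>x\<in>C. P \<bullet> x = 0)"
  then obtain x where x: "P \<in> S2" "\<And>y. y \<in> C \<Longrightarrow> 0 \<le> P \<bullet> y" "x \<in> C" "P \<bullet> x = 0"
    by (auto simp: caps_def inner_commute)
  then have "C \<subseteq> hemisphere P" using assms by (auto simp: hemisphere_def)
  moreover have "x \<in> sboundary C" "x \<in> sboundary (hemisphere P)"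
    using x calculation sboundaryI[of _ P x] by auto
  ultimately show "supporting P C"
    using x unfolding supporting_def supports_at_def by blast
qed

text \<open>Moving from r in direction q covers x as soon as M \<ge> -(r \<bullet> x) / (q \<bullet>
  x); the maximum of these quotients covers the last point and touches it. Applied to a body this
  yields supporting centres, applied to a set of centres it yields boundary points of the
  polar.\<close>

lemma pencil_support:
  fixes C :: "(real^3) set"
  assumes "compact C" "C \<noteq> {}" and q: "\<And>x. x \<in> C \<Longrightarrow> q \<bullet> x > 0"
  obtains M x0 where "x0 \<in> C" "(r + M *\<^sub>R q) \<bullet> x0 = 0" "\<And>x. x \<in> C \<Longrightarrow> 0 \<le> (r + M *\<^sub>R q) \<bullet> x"
    "\<And>x. x \<in> C \<Longrightarrow> r \<bullet> x < 0 \<Longrightarrow> M > 0"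
proof -
  have "continuous_on C (\<lambda>x. - (r \<bullet> x) / (q \<bullet> x))"
    using q by (intro continuous_intros) force
  then obtain x0 where x0: "x0 \<in> C" "\<And>x. x \<in> C \<Longrightarrow> - (r \<bullet> x) / (q \<bullet> x) \<le> - (r \<bullet> x0) / (q \<bullet> x0)"
    using continuous_attains_sup[OF assms(1,2)] by blast
  define M where "M = - (r \<bullet> x0) / (q \<bullet> x0)"
  have ge: "0 \<le> (r + M *\<^sub>R q) \<bullet> x" if "x \<in> C" for x
  proof -
    have "- (r \<bullet> x) / (q \<bullet> x) \<le> M" using x0 that M_def by simp
    then have "- (r \<bullet> x) \<le> M * (q \<bullet> x)" using q[OF that] by (simp only: pos_divide_le_eq)
    then show ?thesis by (simp add: inner_add_left)
  qed
  show ?thesis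
  proof (rule that[of x0 M])
    show "(r + M *\<^sub>R q) \<bullet> x0 = 0" using q[OF x0(1)] by (simp add: M_def inner_diff_left)
    show "M > 0" if "x \<in> C" "r \<bullet> x < 0" for x
    proof -
      have "0 < M * (q \<bullet> x)" using ge[OF that(1)] that(2) by (simp add: inner_add_left)
      then show ?thesis using q[OF that(1)] by (simp add: zero_less_mult_iff)
    qed
  qed (use x0 ge in auto)
qed

section \<open>First-order variation along the sphere\<close>

text \<open>The square root is the norm of P + s t for a tangent vector t: normalising costs only
  second order in s, so a gain of first order prevails.\<close>

lemma eventually_quadratic_bound:
  fixes a k m :: real assumes "a \<ge> 0" "k > 0" "m \<ge> 0"
  shows "eventually (\<lambda>s. a * sqrt (1 + s\<^sup>2 * m) < a + s * k) (at_right 0)"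
proof -
  have "((\<lambda>s. a * (s * m)) \<longlongrightarrow> a * (0 * m)) (at_right 0)"
    by (intro tendsto_intros)
  then have "eventually (\<lambda>s. a * (s * m) < k) (at_right 0)"
    by (rule order_tendstoD) (use assms in auto)
  moreover have "eventually (\<lambda>s. (0::real) < s) (at_right 0)"
    by (simp add: eventually_at_right_less)
  ultimately show ?thesis
  proof eventually_elim
    case (elim s)
    have "sqrt (1 + u) \<le> 1 + u" if "u \<ge> 0" for u :: real
      using that by (intro real_le_lsqrt) (auto simp: power2_eq_square algebra_simps)
    from this[of "s\<^sup>2 * m"] have "sqrt (1 + s\<^sup>2 * m) \<le> 1 + s\<^sup>2 * m"
      using assms by simp
    then have "a * sqrt (1 + s\<^sup>2 * m) \<le> a + s * (a * (s * m))"
      using mult_left_mono[OF _ assms(1)] by (fastforce simp: power2_eq_square algebra_simps)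
    also have "\<dots> < a + s * k" using elim by simp
    finally show ?case .
  qed
qed

lemma norm_add_perp:
  fixes P t :: "'a::real_inner"
  assumes "norm P = 1" "P \<bullet> t = 0"
  shows "norm (P + s *\<^sub>R t) = sqrt (1 + s\<^sup>2 * (norm t)\<^sup>2)"
proof -
  have "norm (P + s *\<^sub>R t) ^ 2 = 1 + s\<^sup>2 * (norm t)\<^sup>2"
    using assms unfolding power2_norm_eq_inner
    by (simp add: inner_add_left inner_add_right inner_commute[of t P] norm_eq_1 power2_eq_square algebra_simps)
  then show ?thesis by (metis norm_ge_zero real_sqrt_unique)
qed

lemma norm_add_perp_ge_1:
  fixes P t :: "'a::real_inner"
  assumes "norm P = 1" "P \<bullet> t = 0"
  shows "1 \<le> norm (P + s *\<^sub>R t)"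
  using norm_add_perp[OF assms] by simp

text \<open>As t is tangent at P, the sign of y \<bullet> t decides to first order. For y \<bullet>
  P \<ge> 0 normalising only helps the decrease; for y \<bullet> P < 0 it works against it, but
  merely by a quadratic amount.\<close>

lemma eventually_inner_sgn_less:
  fixes P t y :: "'a::real_inner"
  assumes "norm P = 1" "P \<bullet> t = 0" "y \<bullet> t < 0"
  shows "eventually (\<lambda>s. y \<bullet> sgn (P + s *\<^sub>R t) < y \<bullet> P) (at_right 0)"
proof -
  have ev0: "eventually (\<lambda>s. (0::real) < s) (at_right 0)"
    by (simp add: eventually_at_right_less)
  have n: "y \<bullet> sgn (P + s *\<^sub>R t) < y \<bullet> P \<longleftrightarrow> y \<bullet> P + s * (y \<bullet> t) < y \<bullet> P * sqrt (1 + s\<^sup>2 * (norm t)\<^sup>2)" for s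
  proof -
    have "norm (P + s *\<^sub>R t) > 0" using norm_add_perp_ge_1[OF assms(1,2), of s] by linarith
    then show ?thesis
      unfolding norm_add_perp[OF assms(1,2), symmetric] by (simp add: inner_sgn divide_less_eq inner_add_right)
  qed
  show ?thesis
  proof (cases "y \<bullet> P \<ge> 0")
    case True
    show ?thesis using ev0
    proof eventually_elim
      case (elim s)
      have "s * (y \<bullet> t) < 0" using elim assms by (simp add: mult_pos_neg)
      moreover have "y \<bullet> P \<le> y \<bullet> P * sqrt (1 + s\<^sup>2 * (norm t)\<^sup>2)" 
        using mult_left_mono[OF _ True, of 1 "sqrt (1 + s\<^sup>2 * (norm t)\<^sup>2)"] by simp
      ultimately show ?case unfolding n by linarith
    qed
  next
    case False
    show ?thesis using eventually_quadratic_bound[of "-(y \<bullet> P)" "-(y \<bullet> t)" "(norm t)\<^sup>2"]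
      using False assms unfolding n by (simp add: algebra_simps)
  qed
qed

lemma eventually_inner_sgn_greater:
  fixes P t y :: "'a::real_inner"
  assumes "norm P = 1" "P \<bullet> t = 0" "y \<bullet> t > 0"
  shows "eventually (\<lambda>s. y \<bullet> P < y \<bullet> sgn (P + s *\<^sub>R t)) (at_right 0)"
  using eventually_inner_sgn_less[of P t "-y"] assms by simp

lemma tendsto_sgn_add:
  fixes P t :: "'a::real_inner"
  assumes "norm P = 1"
  shows "((\<lambda>s. sgn (P + s *\<^sub>R t)) \<longlongrightarrow> P) (at_right 0)"
proof -
  have "((\<lambda>s. sgn (P + s *\<^sub>R t)) \<longlongrightarrow> sgn (P + 0 *\<^sub>R t)) (at_right 0)"
    using assms by (intro tendsto_intros) auto
  then show ?thesis using assms by (simp add: sgn_div_norm)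
qed

lemma eventually_at_right_0D:
  "eventually P (at_right (0::real)) \<Longrightarrow> \<exists>s>0. P s"
  by (metis eventually_at_right_field dense)

section \<open>Polarity of spherically convex sets\<close>

lemma uniform_margin:
  fixes A :: "('a::euclidean_space) set"
  assumes "compact A" "\<And>a. a \<in> A \<Longrightarrow> c < z \<bullet> a"
  obtains \<eta> where "\<eta> > 0" "\<And>a. a \<in> A \<Longrightarrow> c + \<eta> \<le> z \<bullet> a"
proof (cases "A = {}")
  case True
  then show ?thesis using that[of 1] by simp
next
  case False
  have "continuous_on A (\<lambda>a. z \<bullet> a)" by (intro continuous_intros)
  then obtain a where "a \<in> A" "\<And>b. b \<in> A \<Longrightarrow> z \<bullet> a \<le> z \<bullet> b"
    using continuous_attains_inf[OF assms(1) False] by blast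
  then show ?thesis using that[of "z \<bullet> a - c"] assms by simp
qed

lemma hemisphericalD:
  assumes "hemispherical X"
  obtains q where "norm q = 1" "\<And>x. x \<in> X \<Longrightarrow> q \<bullet> x > 0"
proof -
  obtain P where "P \<in> S2" "hemisphere P \<inter> X = {}" "X \<subseteq> S2"
    using assms by (auto simp: hemispherical_def)
  then have "norm (-P) = 1" "\<And>x. x \<in> X \<Longrightarrow> (-P) \<bullet> x > 0"
    by (simp, metis (mono_tags, lifting) IntI emptyE hemisphere_def inner_minus_left mem_Collect_eq neg_0_less_iff_less not_le subsetD)
  then show ?thesis using that by blast
qed

lemma hemisphericalI:
  assumes "X \<subseteq> S2" "norm q = 1" "\<And>x. x \<in> X \<Longrightarrow> q \<bullet> x > 0"
  shows "hemispherical X"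
proof -
  have "hemisphere (-q) \<inter> X = {}" using assms(3) by (force simp: hemisphere_def)
  then show ?thesis using assms(1,2) unfolding hemispherical_def by (intro conjI bexI[of _ "-q"]) auto
qed

lemma sgn_in_spherical_convex:
  assumes "spherical_convex X" "P \<in> X" "Q \<in> X" "a \<ge> 0" "b \<ge> 0" "a *\<^sub>R P + b *\<^sub>R Q \<noteq> 0"
  shows "sgn (a *\<^sub>R P + b *\<^sub>R Q) \<in> X"
proof -
  define p where "p = a *\<^sub>R P + b *\<^sub>R Q"
  have "sgn p = (a / norm p) *\<^sub>R P + (b / norm p) *\<^sub>R Q"
    unfolding sgn_div_norm by (simp add: p_def scaleR_add_right divide_inverse_commute)
  moreover have "norm (sgn p) = 1" using assms by (simp add: norm_sgn p_def)
  moreover have "a / norm p \<ge> 0" "b / norm p \<ge> 0" using assms by simp_all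
  ultimately have "sgn p \<in> gc_arc P Q"
    unfolding gc_arc_def by (simp del: zero_le_divide_iff) blast
  then show ?thesis using assms(1-3) unfolding spherical_convex_def p_def by blast
qed

text \<open>The cone over X without its apex is convex: q keeps positive combinations away from 0,
  and arcs keep their directions in X. This opens X to separation theorems of Euclidean
  space.\<close>

lemma convex_hull_spherical_convex:
  assumes "spherical_convex X" "y \<in> convex hull X"
  shows "y \<noteq> 0" "sgn y \<in> X"
proof -
  obtain q where q: "norm q = 1" "\<And>x. x \<in> X \<Longrightarrow> q \<bullet> x > 0"
    using assms by (meson hemisphericalD spherical_convex_def)
  have XS: "X \<subseteq> S2" using assms by (simp add: spherical_convex_def hemispherical_def)
  define T where "T = {y. y \<noteq> 0 \<and> sgn y \<in> X}"
  have qT: "q \<bullet> y > 0" if "y \<in> T" for y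
  proof -
    have "q \<bullet> sgn y > 0" using that q by (auto simp: T_def)
    then show ?thesis by (simp add: inner_sgn zero_less_divide_iff)
  qed
  have "convex T"
    unfolding convex_def
  proof (intro ballI allI impI)
    fix x y and u v :: real
    assume xy: "x \<in> T" "y \<in> T" and uv: "0 \<le> u" "0 \<le> v" "u + v = 1"
    have "q \<bullet> (u *\<^sub>R x + v *\<^sub>R y) > 0"
    proof (cases "u = 0")
      case True
      then show ?thesis using qT xy uv by simp
    next
      case False
      then show ?thesis using qT[OF xy(1)] qT[OF xy(2)] uv
        by (simp add: inner_add_right add_pos_nonneg)
    qed
    then have ne: "u *\<^sub>R x + v *\<^sub>R y \<noteq> 0" by auto
    have "u *\<^sub>R x + v *\<^sub>R y = (u * norm x) *\<^sub>R sgn x + (v * norm y) *\<^sub>R sgn y"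
      using xy by (simp add: sgn_div_norm T_def mult.assoc)
    then show "u *\<^sub>R x + v *\<^sub>R y \<in> T"
      using sgn_in_spherical_convex[of X "sgn x" "sgn y" "u * norm x" "v * norm y"] ne xy uv assms(1)
      by (auto simp: T_def)
  qed
  moreover have "X \<subseteq> T" using XS by (auto simp: T_def sgn_div_norm)
  ultimately have "convex hull X \<subseteq> T" by (rule hull_minimal[rotated])
  then show "y \<noteq> 0" "sgn y \<in> X" using assms(2) by (auto simp: T_def)
qed

lemma bipolar:
  assumes X: "compact X" "spherical_convex X" "X \<noteq> {}"
  shows "caps 0 (caps 0 X) \<subseteq> X"
proof
  fix x assume x: "x \<in> caps 0 (caps 0 X)"
  show "x \<in> X"
  proof (rule ccontr)
    assume nx: "x \<notin> X"
    have nx1: "norm x = 1" using x by (simp add: caps_def)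
    \<comment> \<open>Separating the whole ray instead of the point x forces a \<bullet> x \<le> 0,
      because a functional bounded above on a ray from 0 cannot be positive on it.\<close>
    define R where "R = (\<lambda>t. t *\<^sub>R x) ` {0..}"
    have dis: "R \<inter> convex hull X = {}"
    proof (rule ccontr)
      assume "R \<inter> convex hull X \<noteq> {}"
      then obtain t where t: "t \<ge> 0" "t *\<^sub>R x \<in> convex hull X" by (auto simp: R_def)
      then have "sgn (t *\<^sub>R x) \<in> X" "t *\<^sub>R x \<noteq> 0"
        using convex_hull_spherical_convex[OF X(2)] by blast+
      moreover have "sgn (t *\<^sub>R x) = x" using calculation t nx1 
        by (simp add: sgn_div_norm)
      ultimately show False using nx by simp
    qed
    have "R = {y. y = (x \<bullet> y) *\<^sub>R x} \<inter> {y. 0 \<le> x \<bullet> y}"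
      using nx1 by (auto simp: R_def norm_eq_1 image_iff)
    then have "closed R"
      by (simp add: closed_Int closed_Collect_eq closed_Collect_le continuous_intros)
    moreover have "convex R" unfolding R_def
      by (intro convex_linear_image) (auto simp: linear_iff scaleR_add_left)
    moreover have "0 \<in> R" unfolding R_def by (rule image_eqI[of _ _ 0]) auto
    moreover have "compact (convex hull X)" "convex (convex hull X)"
      using X by (auto intro: compact_convex_hull)
    moreover have "convex hull X \<noteq> {}" using X(3) by simp
    ultimately obtain a b where ab: "\<And>y. y \<in> R \<Longrightarrow> a \<bullet> y < b" "\<And>y. y \<in> convex hull X \<Longrightarrow> a \<bullet> y > b"
      using separating_hyperplane_closed_compact[of R "convex hull X"] dis by blast
    have b0: "b > 0" using ab(1)[OF \<open>0 \<in> R\<close>] by simp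
    have ax: "a \<bullet> x \<le> 0"
    proof (rule ccontr)
      assume "\<not> a \<bullet> x \<le> 0"
      then have "((b / (a \<bullet> x)) *\<^sub>R x) \<in> R" "a \<bullet> ((b / (a \<bullet> x)) *\<^sub>R x) = b"
        using b0 by (auto simp: R_def)
      then show False using ab(1)[of "(b / (a \<bullet> x)) *\<^sub>R x"] by simp
    qed
    \<comment> \<open>Since a \<bullet> x may vanish, b x is subtracted to make the sign at x
      strict; X stays on the nonnegative side because a \<bullet> y > b \<ge> b (x \<bullet>
      y).\<close>
    define p where "p = a - b *\<^sub>R x"
    have px: "p \<bullet> x < 0" using ax b0 nx1 by (simp add: p_def inner_diff_left norm_eq_1)
    then have p0: "p \<noteq> 0" by auto
    have "p \<bullet> y \<ge> 0" if "y \<in> X" for y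
    proof -
      have "b < a \<bullet> y" using ab(2) that hull_inc by metis
      moreover have "norm y = 1" using X that by (auto simp: spherical_convex_def hemispherical_def)
      then have "b * (x \<bullet> y) \<le> b" using inner_le_1[OF nx1] b0 by simp
      ultimately show ?thesis by (simp add: p_def inner_diff_left)
    qed
    then have "sgn p \<in> caps 0 X" using p0 by (intro sgn_in_polar) (auto simp: inner_commute)
    then have "0 \<le> sgn p \<bullet> x" using capsD(2)[OF x] by blast
    then show False using px p0 by (simp add: sgn_div_norm zero_le_mult_iff)
  qed
qed

lemma sinterior_pos:
  assumes "x \<in> sinterior X" "P \<in> caps 0 X" "X \<subseteq> S2"
  shows "P \<bullet> x > 0"
proof -
  have xX: "x \<in> X" using assms(1) interior_of_subset by fast
  have "x \<notin> sboundary X" using assms(1) by (simp add: frontier_of_def)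
  moreover have "X \<subseteq> hemisphere P" "norm P = 1" using assms 
    by (auto simp: hemisphere_def caps_def inner_commute)
  ultimately have "P \<bullet> x \<noteq> 0" using sboundaryI xX by blast
  moreover have "P \<bullet> x \<ge> 0" using capsD(2)[OF assms(2) xX] by (simp add: inner_commute)
  ultimately show ?thesis by simp
qed

text \<open>Thickness grows with P \<bullet> Q, so the minimum in \<open>width\<close> belongs to
  the supporting centre farthest from P.\<close>

lemma width_eq:
  assumes "supporting Q0 C" "Q0 \<noteq> P" "Q0 \<noteq> - P" "norm P = 1"
    and min: "\<And>Q. supporting Q C \<Longrightarrow> P \<bullet> Q0 \<le> P \<bullet> Q"
  shows "width P C = pi - arccos (P \<bullet> Q0)"
  unfolding width_def
proof (rule Least_equality)
  show "\<exists>Q. supporting Q C \<and> Q \<noteq> P \<and> Q \<noteq> - P \<and> pi - arccos (P \<bullet> Q0) = lune_thickness P Q"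
    using assms by (auto simp: lune_thickness_def sdist_def)
next
  fix t assume "\<exists>Q. supporting Q C \<and> Q \<noteq> P \<and> Q \<noteq> - P \<and> t = lune_thickness P Q"
  then obtain Q where Q: "supporting Q C" "t = pi - arccos (P \<bullet> Q)"
    by (auto simp: lune_thickness_def sdist_def)
  have "norm Q = 1" "norm Q0 = 1" using Q assms by (auto simp: supporting_def supports_at_def)
  then have "arccos (P \<bullet> Q) \<le> arccos (P \<bullet> Q0)"
    using min[OF Q(1)] assms inner_le_1 inner_ge_minus_1 by (intro arccos_le_arccos) auto
  then show "pi - arccos (P \<bullet> Q0) \<le> t" using Q by simp
qed

text \<open>The centres of the supporting hemispheres, see \<open>supporting_iff\<close>.\<close>

definition csupp :: "(real^3) set \<Rightarrow> (real^3) set" where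
  "csupp C = {P \<in> caps 0 C. \<exists>x\<in>C. P \<bullet> x = 0}"

lemma compact_csupp:
  assumes "compact C" shows "compact (csupp C)"
proof -
  have "csupp C = fst ` ((caps 0 C \<times> C) \<inter> {z. fst z \<bullet> snd z = 0})"
  proof (intro equalityI subsetI)
    fix P assume "P \<in> csupp C"
    then obtain x where "(P, x) \<in> (caps 0 C \<times> C) \<inter> {z. fst z \<bullet> snd z = 0}"
      by (auto simp: csupp_def)
    then show "P \<in> fst ` ((caps 0 C \<times> C) \<inter> {z. fst z \<bullet> snd z = 0})"
      by (rule image_eqI[rotated]) simp
  qed (auto simp: csupp_def)
  moreover have "closed {z :: (real^3) \<times> (real^3). fst z \<bullet> snd z = 0}"
    by (intro closed_Collect_eq continuous_intros)
  then have "compact ((caps 0 C \<times> C) \<inter> {z. fst z \<bullet> snd z = 0})"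
    by (rule compact_Int_closed[OF compact_Times[OF compact_caps assms]])
  ultimately show ?thesis
    by (simp add: compact_continuous_image continuous_on_fst)
qed

lemma perp_exists:
  obtains w :: "real^3" where "norm w = 1" "q \<bullet> w = 0"
proof (cases "q = 0")
  case True
  then show ?thesis using that[of "axis 1 1"] by simp
next
  case False
  then obtain i where "cross3 q (axis i 1) \<noteq> 0" using cross_basis_nonzero by blast
  then show ?thesis
    using that[of "sgn (cross3 q (axis i 1))"] by (simp add: norm_sgn inner_sgn dot_cross_self)
qed

section \<open>Polars of bodies of constant width\<close>

lemma spherical_convex_bodyD:
  assumes "spherical_convex_body C"
  shows "compact C" "C \<subseteq> S2" "C \<noteq> {}" "spherical_convex C"
  using assms interior_of_subset[of "top_of_set S2" C]
  by (auto simp: spherical_convex_body_def closedin_S2_iff)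

text \<open>The pencil starts at w orthogonal to q with w \<bullet> P \<le> 0. Adding multiples of q
  keeps w \<bullet> p = 1, so the resulting centre cannot be P. This is how the minimum in
  \<open>width\<close> is kept from being taken over an empty set.\<close>

lemma csupp_other:
  assumes "compact C" "C \<noteq> {}" and q: "\<And>x. x \<in> C \<Longrightarrow> q \<bullet> x > 0"
  obtains Q where "Q \<in> csupp C" "Q \<noteq> P"
proof -
  obtain w0 :: "real^3" where w0: "norm w0 = 1" "q \<bullet> w0 = 0" by (rule perp_exists)
  define w where "w = (if w0 \<bullet> P \<le> 0 then w0 else - w0)"
  have w: "norm w = 1" "q \<bullet> w = 0" "w \<bullet> P \<le> 0" using w0 by (auto simp: w_def)
  obtain M x0 where M: "x0 \<in> C" "(w + M *\<^sub>R q) \<bullet> x0 = 0" "\<And>x. x \<in> C \<Longrightarrow> 0 \<le> (w + M *\<^sub>R q) \<bullet> x"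
    using pencil_support[OF assms(1,2) q] by metis
  define p where "p = w + M *\<^sub>R q"
  have pw: "w \<bullet> p = 1" using w by (simp add: p_def inner_add_right norm_eq_1 inner_commute)
  then have p0: "p \<noteq> 0" by auto
  have "sgn p \<in> caps 0 C" using M(3) p0 by (intro sgn_in_polar) (auto simp: inner_commute p_def)
  moreover have "sgn p \<bullet> x0 = 0" using M(2) by (simp add: sgn_div_norm p_def)
  moreover have "w \<bullet> sgn p > 0" using pw p0 by (simp add: inner_sgn)
  then have "sgn p \<noteq> P" using w by auto
  ultimately show ?thesis using that M(1) by (auto simp: csupp_def)
qed

text \<open>Reads constant width off the centres: the farthest supporting centre from each P has
  inner product exactly c with it. The farthest centre is admissible in \<open>width\<close> because
  a second supporting centre rules out P, and an interior point of C rules out -P.\<close>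

lemma constant_width_csupp:
  assumes "\<tau> > pi / 2" "spherical_convex_body C" "constant_width C \<tau>"
  defines "c \<equiv> cos (pi - \<tau>)"
  shows "csupp C \<noteq> {}" "0 < c" "c < 1" "\<tau> < pi"
    and "P \<in> csupp C \<Longrightarrow> Q \<in> csupp C \<Longrightarrow> c \<le> P \<bullet> Q"
    and "P \<in> csupp C \<Longrightarrow> \<exists>Q\<in>csupp C. P \<bullet> Q = c"
proof -
  note C = spherical_convex_bodyD[OF assms(2)]
  obtain q where q: "norm q = 1" "\<And>x. x \<in> C \<Longrightarrow> q \<bullet> x > 0"
    using C(4) by (meson hemisphericalD spherical_convex_def)
  obtain z where z: "z \<in> sinterior C" using assms by (auto simp: spherical_convex_body_def)
  have supp: "supporting P C \<longleftrightarrow> P \<in> csupp C" for P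
    using supporting_iff[OF C(1,2)] by (simp add: csupp_def)
  have n1: "norm P = 1" if "P \<in> csupp C" for P using that capsD by (auto simp: csupp_def)
  show ne: "csupp C \<noteq> {}" using csupp_other[OF C(1,3) q(2)] by blast
  have key: "\<exists>Q0\<in>csupp C. \<tau> = pi - arccos (P \<bullet> Q0) \<and> -1 < P \<bullet> Q0 \<and> P \<bullet> Q0 < 1 \<and> (\<forall>Q\<in>csupp C. P \<bullet> Q0 \<le> P \<bullet> Q)"
    if P: "P \<in> csupp C" for P
  proof -
    have "continuous_on (csupp C) (\<lambda>Q. P \<bullet> Q)" by (intro continuous_intros)
    then obtain Q0 where Q0: "Q0 \<in> csupp C" "\<And>Q. Q \<in> csupp C \<Longrightarrow> P \<bullet> Q0 \<le> P \<bullet> Q"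
      using continuous_attains_inf[OF compact_csupp[OF C(1)] ne] by blast
    obtain Q1 where Q1: "Q1 \<in> csupp C" "Q1 \<noteq> P" by (rule csupp_other[OF C(1,3) q(2)])
    have "P \<bullet> Q1 \<noteq> 1" using Q1 inner_eq_1D n1 P by metis
    then have lt: "P \<bullet> Q0 < 1"
      using Q0(2)[OF Q1(1)] inner_le_1[OF n1[OF P] n1[OF Q1(1)]] by simp
    have "P \<bullet> z > 0" "Q0 \<bullet> z > 0"
      using sinterior_pos[OF z _ C(2)] P Q0 by (auto simp: csupp_def)
    then have nm: "Q0 \<noteq> - P" by auto
    have np: "Q0 \<noteq> P" using lt n1[OF P] by (auto simp: norm_eq_1)
    have "P \<bullet> Q0 \<noteq> -1" using nm inner_eq_minus_1D n1 P Q0 by (metis inner_commute)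
    then have gt: "-1 < P \<bullet> Q0" using inner_ge_minus_1[OF n1[OF P] n1[OF Q0(1)]] by simp
    have "width P C = pi - arccos (P \<bullet> Q0)"
      using Q0 np nm n1 P by (intro width_eq) (auto simp: supp)
    moreover have "width P C = \<tau>" using assms(3) P by (simp add: constant_width_def supp)
    ultimately show ?thesis using Q0 lt gt by auto
  qed
  have c: "c = P \<bullet> Q0" if "\<tau> = pi - arccos (P \<bullet> Q0)" "-1 < P \<bullet> Q0" "P \<bullet> Q0 < 1" for P Q0 :: "real^3"
    using that by (simp add: c_def)
  obtain P where P: "P \<in> csupp C" using ne by auto
  from key[OF P] obtain Q0 where Q0: "\<tau> = pi - arccos (P \<bullet> Q0)" "-1 < P \<bullet> Q0" "P \<bullet> Q0 < 1" by auto
  show "c < 1" using c[OF Q0] Q0 by simp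
  have "0 < arccos (P \<bullet> Q0)" using arccos_lt_bounded[OF Q0(2,3)] by simp
  then show "\<tau> < pi" using Q0 by simp
  then show "0 < c" unfolding c_def using assms(1) by (intro cos_gt_zero) auto
  show "c \<le> P \<bullet> Q" if "P \<in> csupp C" "Q \<in> csupp C" for P Q
    using key[OF that(1)] c that(2) by fastforce
  show "\<exists>Q\<in>csupp C. P \<bullet> Q = c" if "P \<in> csupp C" for P
    using key[OF that(1)] c by fastforce
qed

text \<open>A centre P outside \<open>csupp C\<close> has a positive margin on the compact set C. It
  can then move a little along t, the tangent direction at P pointing away from y, without leaving
  the polar, and this lowers y \<bullet> P. Excluding y = P and y = -P makes t nonzero.\<close>

lemma polar_min_in_csupp:
  assumes C: "compact C" "C \<subseteq> S2" and P: "P \<in> caps 0 C" and y: "norm y = 1" "y \<noteq> P" "y \<noteq> - P"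
    and min: "\<And>P'. P' \<in> caps 0 C \<Longrightarrow> y \<bullet> P \<le> y \<bullet> P'"
  shows "P \<in> csupp C"
proof (rule ccontr)
  assume "P \<notin> csupp C"
  then have "P \<bullet> x > 0" if "x \<in> C" for x
    using that P capsD(2)[OF P that] by (force simp: csupp_def inner_commute order_less_le)
  then obtain \<eta> where \<eta>: "\<eta> > 0" "\<And>x. x \<in> C \<Longrightarrow> 0 + \<eta> \<le> P \<bullet> x"
    using uniform_margin[OF C(1)] by metis
  have n: "norm P = 1" using P capsD by blast
  define t where "t = (y \<bullet> P) *\<^sub>R P - y"
  have Pt: "P \<bullet> t = 0" using n by (simp add: t_def inner_diff_right norm_eq_1 inner_commute)
  have "\<bar>y \<bullet> P\<bar> < 1"
    using inner_le_1[OF y(1) n] inner_ge_minus_1[OF y(1) n] inner_eq_1D[OF y(1) n] inner_eq_minus_1D[OF y(1) n] y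
    by force
  then have "(y \<bullet> P)\<^sup>2 < 1" by (simp add: abs_square_less_1)
  then have yt: "y \<bullet> t < 0" using y by (simp add: t_def inner_diff_right norm_eq_1 power2_eq_square)
  have "((\<lambda>s. s * norm t) \<longlongrightarrow> 0 * norm t) (at_right 0)" by (intro tendsto_intros)
  then have "eventually (\<lambda>s. s * norm t < \<eta>) (at_right 0)"
    by (rule order_tendstoD) (use \<eta> in auto)
  with eventually_inner_sgn_less[OF n Pt yt] have "eventually (\<lambda>s. y \<bullet> sgn (P + s *\<^sub>R t) < y \<bullet> P \<and> s * norm t < \<eta>) (at_right 0)"
    by eventually_elim auto
  then obtain s where s: "s > 0" "y \<bullet> sgn (P + s *\<^sub>R t) < y \<bullet> P" "s * norm t < \<eta>"
    using eventually_at_right_0D by blast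
  have "sgn (P + s *\<^sub>R t) \<in> caps 0 C"
  proof (rule sgn_in_polar)
    show "P + s *\<^sub>R t \<noteq> 0" using norm_add_perp_ge_1[OF n Pt, of s] by auto
    fix x assume x: "x \<in> C"
    then have "norm x = 1" using C by auto
    then have "\<bar>s * (t \<bullet> x)\<bar> \<le> s * norm t" using s Cauchy_Schwarz_ineq2[of t x] by (simp add: abs_mult)
    then show "0 \<le> x \<bullet> (P + s *\<^sub>R t)"
      using \<eta>(2)[OF x] s by (simp add: inner_add_right inner_commute)
  qed
  then show False using min s by force
qed

text \<open>The point of the polar farthest from a given y is y itself or a supporting centre, so
  bounds known on \<open>csupp C\<close> extend to the polar. Completeness is strict convexity: no
  point strictly between two points of a ball lies on its boundary.\<close>

lemma polar_constant_width:
  assumes "\<tau> > pi / 2" "spherical_convex_body C" "constant_width C \<tau>"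
  defines "c \<equiv> cos (pi - \<tau>)"
  shows polar_diameter: "\<And>P Q. P \<in> caps 0 C \<Longrightarrow> Q \<in> caps 0 C \<Longrightarrow> c \<le> P \<bullet> Q"
    and polar_complete: "caps c (caps 0 C) \<subseteq> caps 0 C"
proof -
  note C = spherical_convex_bodyD[OF assms(2)]
  note cw = constant_width_csupp[OF assms(1-3), folded c_def]
  obtain q where q: "norm q = 1" "\<And>x. x \<in> C \<Longrightarrow> q \<bullet> x > 0"
    using C(4) by (meson hemisphericalD spherical_convex_def)
  obtain z where z: "z \<in> sinterior C" using assms by (auto simp: spherical_convex_body_def)
  have qK: "q \<in> caps 0 C" using q less_imp_le by (auto simp: caps_def inner_commute)
  then have Kne: "caps 0 C \<noteq> {}" by auto
  have min: "\<exists>P\<in>caps 0 C. (\<forall>P'\<in>caps 0 C. y \<bullet> P \<le> y \<bullet> P') \<and> (P \<in> csupp C \<or> P = y)" if y: "y \<in> caps 0 C" for y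
  proof -
    have "continuous_on (caps 0 C) (\<lambda>Q. y \<bullet> Q)" by (intro continuous_intros)
    then obtain P where P: "P \<in> caps 0 C" "\<And>Q. Q \<in> caps 0 C \<Longrightarrow> y \<bullet> P \<le> y \<bullet> Q"
      using continuous_attains_inf[OF compact_caps Kne] by blast
    have "P \<bullet> z > 0" "y \<bullet> z > 0" using sinterior_pos[OF z _ C(2)] P y by auto
    then have "y \<noteq> - P" by auto
    then show ?thesis using polar_min_in_csupp[OF C(1,2) P(1), of y] P y capsD(1)[OF y] by metis
  qed
  \<comment> \<open>The bound is extended one argument at a time: here one point still supports, and
    in \<open>dia\<close> the minimiser takes over that role.\<close>
  have 1: "c \<le> P \<bullet> y" if P: "P \<in> csupp C" and y: "y \<in> caps 0 C" for P y
  proof -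
    have PK: "P \<in> caps 0 C" using P by (simp add: csupp_def)
    from min[OF PK] obtain P0 where P0: "P0 \<in> caps 0 C" "P \<bullet> P0 \<le> P \<bullet> y" "P0 \<in> csupp C \<or> P0 = P"
      using y by blast
    show ?thesis
    proof (cases "P0 = P")
      case True
      then have "P \<bullet> P0 = 1" using capsD(1)[OF PK] by (simp add: norm_eq_1)
      then show ?thesis using P0 cw by linarith
    next
      case False
      then have "c \<le> P \<bullet> P0" using cw(5)[OF P] P0 by simp
      then show ?thesis using P0 by linarith
    qed
  qed
  show dia: "c \<le> P \<bullet> Q" if P: "P \<in> caps 0 C" and Q: "Q \<in> caps 0 C" for P Q
  proof -
    from min[OF P] obtain P0 where P0: "P0 \<in> caps 0 C" "P \<bullet> P0 \<le> P \<bullet> Q" "P0 \<in> csupp C \<or> P0 = P"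
      using Q by blast
    show ?thesis
    proof (cases "P0 = P")
      case True
      then have "P \<bullet> P0 = 1" using capsD(1)[OF P] by (simp add: norm_eq_1)
      then show ?thesis using P0 cw by linarith
    next
      case False
      then have "c \<le> P0 \<bullet> P" using 1 P P0 by simp
      then show ?thesis using P0 by (simp add: inner_commute)
    qed
  qed
  show "caps c (caps 0 C) \<subseteq> caps 0 C"
  proof
    fix R assume R: "R \<in> caps c (caps 0 C)"
    have nR: "norm R = 1" using capsD(1)[OF R] .
    show "R \<in> caps 0 C"
    proof (rule ccontr)
      assume nRK: "R \<notin> caps 0 C"
      then obtain x where x: "x \<in> C" "R \<bullet> x < 0" using nR by (auto simp: caps_def inner_commute)
      obtain M x0 where M: "x0 \<in> C" "(R + M *\<^sub>R q) \<bullet> x0 = 0" "\<And>x. x \<in> C \<Longrightarrow> 0 \<le> (R + M *\<^sub>R q) \<bullet> x" "M > 0"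
        using pencil_support[OF C(1,3) q(2)] x by metis
      \<comment> \<open>The centre \<open>sgn p\<close> lies strictly between R and q. Both are in
        the ball about every Q of the polar, so \<open>sgn p\<close> would be strictly inside that
        ball, against the existence of a partner Q at inner product exactly c.\<close>
      define p where "p = R + M *\<^sub>R q"
      have Rq: "c \<le> q \<bullet> R" using capsD(2)[OF R qK] .
      have "q \<bullet> p > 0" using Rq M cw(2) q(1) by (simp add: p_def inner_add_right norm_eq_1)
      then have p0: "p \<noteq> 0" by auto
      have P: "sgn p \<in> csupp C"
        using M p0 sgn_in_polar[of p C] by (auto simp: csupp_def p_def inner_commute sgn_div_norm)
      then obtain Q where Q: "Q \<in> csupp C" "sgn p \<bullet> Q = c" using cw(6) by blast
      have QK: "Q \<in> caps 0 C" using Q by (simp add: csupp_def)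
      have "norm p < 1 + M"
      proof -
        have "R \<noteq> q" using nRK qK by auto
        then have "norm (R + M *\<^sub>R q) \<noteq> norm R + norm (M *\<^sub>R q)"
          using nR q(1) M(4) norm_triangle_eq[of R "M *\<^sub>R q"] by auto
        then show ?thesis using norm_triangle_ineq[of R "M *\<^sub>R q"] nR q(1) M(4) by (simp add: p_def)
      qed
      then have "c * norm p < c * (1 + M)" using cw(2) by simp
      also have "\<dots> \<le> Q \<bullet> R + M * (Q \<bullet> q)"
        using capsD(2)[OF R QK] mult_left_mono[OF dia[OF QK qK], of M] M(4)
        by (simp add: distrib_left mult.commute[of c M] add_mono)
      also have "\<dots> = Q \<bullet> p" by (simp add: p_def inner_add_right)
      also have "\<dots> = c * norm p"
        using Q(2) p0 by (simp add: inner_commute[of "sgn p"] inner_sgn field_simps)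
      finally show False by simp
    qed
  qed
qed

section \<open>Diameters of finite sets\<close>

text \<open>Cramer's rule without division. For dependent u, v, w the right side vanishes and the
  identity exhibits the linear dependence.\<close>

lemma cramer_identity:
  fixes u v w x :: "real^3"
  shows "(x \<bullet> cross3 v w) *\<^sub>R u + (x \<bullet> cross3 w u) *\<^sub>R v + (x \<bullet> cross3 u v) *\<^sub>R w = (u \<bullet> cross3 v w) *\<^sub>R x"
  by (simp add: cross3_simps forall_3)

text \<open>In the plane orthogonal to x, a vanishing determinant means that v and w are parallel;
  equal lengths and an acute angle then make them equal.\<close>

lemma cross_perp_nonzero:
  fixes v w x :: "real^3"
  assumes "x \<noteq> 0" "x \<bullet> v = 0" "x \<bullet> w = 0" "norm v = r" "norm w = r" "v \<bullet> w > 0" "v \<noteq> w"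
  shows "x \<bullet> cross3 v w \<noteq> 0"
proof
  assume "x \<bullet> cross3 v w = 0"
  moreover have "cross3 x (cross3 v w) = 0" using assms Lagrange by simp
  ultimately have "cross3 v w = 0" using norm_and_cross_eq_0 assms(1) by blast
  then have "(v \<bullet> w)\<^sup>2 = (r * r)\<^sup>2" using norm_cross[of v w] assms(4,5) by (simp add: power_mult_distrib)
  moreover have "r \<ge> 0" using assms(4) by auto
  ultimately have "v \<bullet> w = r * r" using assms(6) by (simp add: power2_eq_iff_nonneg)
  then have "norm v *\<^sub>R w = norm w *\<^sub>R v" using assms(4,5) norm_cauchy_schwarz_eq[of v w] by simp
  moreover have "r \<noteq> 0" using assms(4,6) by auto
  ultimately show False using assms(4,5,7) by simp
qed

text \<open>Coplanar vectors satisfy a relation with coefficients \<alpha>, \<beta>, \<gamma>, all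
  nonzero by \<open>cross_perp_nonzero\<close>. They cannot share a sign, as the inner product of
  the relation with u shows, so one is opposite to the other two and its vector is the middle
  one.\<close>

lemma middle_of_three:
  fixes u v w x :: "real^3"
  assumes x: "x \<noteq> 0" "x \<bullet> u = 0" "x \<bullet> v = 0" "x \<bullet> w = 0"
    and n: "norm u = r" "norm v = r" "norm w = r"
    and pos: "u \<bullet> v > 0" "v \<bullet> w > 0" "w \<bullet> u > 0"
    and ne: "u \<noteq> v" "v \<noteq> w" "w \<noteq> u"
  shows "\<exists>m a b \<mu> \<nu>. {m, a, b} = {u, v, w} \<and> a \<noteq> b \<and> \<mu> > 0 \<and> \<nu> > 0 \<and> m = \<mu> *\<^sub>R a + \<nu> *\<^sub>R b"
proof -
  define \<alpha> \<beta> \<gamma> where "\<alpha> = x \<bullet> cross3 v w" and "\<beta> = x \<bullet> cross3 w u" and "\<gamma> = x \<bullet> cross3 u v"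
  have nz: "\<alpha> \<noteq> 0" "\<beta> \<noteq> 0" "\<gamma> \<noteq> 0"
    unfolding \<alpha>_def \<beta>_def \<gamma>_def
    using cross_perp_nonzero[of x v w r] cross_perp_nonzero[of x w u r] cross_perp_nonzero[of x u v r] assms
    by blast+
  have "x \<bullet> ((u \<bullet> cross3 v w) *\<^sub>R x) = 0"
    using x unfolding cramer_identity[of x v w u, symmetric] by (simp add: inner_add_right)
  then have dep: "\<alpha> *\<^sub>R u + \<beta> *\<^sub>R v + \<gamma> *\<^sub>R w = 0"
    using x(1) unfolding \<alpha>_def \<beta>_def \<gamma>_def cramer_identity by simp
  have mid: "\<exists>\<mu> \<nu>. \<mu> > 0 \<and> \<nu> > 0 \<and> m = \<mu> *\<^sub>R a + \<nu> *\<^sub>R b"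
    if "p *\<^sub>R m + q *\<^sub>R a + s *\<^sub>R b = 0" "p * q < 0" "p * s < 0" for p q s :: real and m a b :: "real^3"
  proof (intro exI conjI)
    have p: "p \<noteq> 0" using that by auto
    show "0 < - q / p" "0 < - s / p" using that(2,3) unfolding zero_less_divide_iff mult_less_0_iff by auto
    have "m = (1 / p) *\<^sub>R (p *\<^sub>R m)" using p by simp
    also have "p *\<^sub>R m = - q *\<^sub>R a - s *\<^sub>R b"
      using that(1) by (simp add: algebra_simps eq_neg_iff_add_eq_0)
    finally show "m = (- q / p) *\<^sub>R a + (- s / p) *\<^sub>R b" using p by (simp add: scaleR_diff_right)
  qed
  have "u \<bullet> u > 0" using pos(1) by auto
  have "u \<bullet> (\<alpha> *\<^sub>R u + \<beta> *\<^sub>R v + \<gamma> *\<^sub>R w) = 0" using dep by simp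
  then have sum: "\<alpha> * (u \<bullet> u) + \<beta> * (u \<bullet> v) + \<gamma> * (w \<bullet> u) = 0"
    by (simp add: inner_add_right inner_commute)
  have "\<not> (\<alpha> > 0 \<and> \<beta> > 0 \<and> \<gamma> > 0)"
    using sum pos \<open>u \<bullet> u > 0\<close> by (metis add_pos_pos less_irrefl mult_pos_pos)
  moreover have "\<not> (\<alpha> < 0 \<and> \<beta> < 0 \<and> \<gamma> < 0)"
    using sum pos \<open>u \<bullet> u > 0\<close> by (metis add_neg_neg less_irrefl mult_neg_pos)
  ultimately consider "\<alpha> * \<beta> < 0" "\<alpha> * \<gamma> < 0" | "\<beta> * \<gamma> < 0" "\<beta> * \<alpha> < 0" | "\<gamma> * \<alpha> < 0" "\<gamma> * \<beta> < 0"
    using nz unfolding mult_less_0_iff by (metis linorder_neqE_linordered_idom)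
  then show ?thesis
  proof cases
    case 1
    show ?thesis using mid[OF dep 1] ne by (intro exI[of _ u] exI[of _ v] exI[of _ w]) auto
  next
    case 2
    have "\<beta> *\<^sub>R v + \<gamma> *\<^sub>R w + \<alpha> *\<^sub>R u = 0" using dep by (simp add: ac_simps)
    from mid[OF this 2] ne show ?thesis by (intro exI[of _ v] exI[of _ w] exI[of _ u]) auto
  next
    case 3
    have "\<gamma> *\<^sub>R w + \<alpha> *\<^sub>R u + \<beta> *\<^sub>R v = 0" using dep by (simp add: ac_simps)
    from mid[OF this 3] ne show ?thesis by (intro exI[of _ w] exI[of _ u] exI[of _ v]) auto
  qed
qed

text \<open>Since c is a cosine, the bound on the angular diameter is arccos c and the inequality is
  reversed. Stating it as an inclusion in \<open>caps\<close> also records that E lies on the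
  sphere.\<close>

definition diam_le :: "real \<Rightarrow> (real^3) set \<Rightarrow> bool" where
  "diam_le c E \<longleftrightarrow> E \<subseteq> caps c E"

lemma diam_leD: "diam_le c E \<Longrightarrow> p \<in> E \<Longrightarrow> norm p = 1" "diam_le c E \<Longrightarrow> p \<in> E \<Longrightarrow> q \<in> E \<Longrightarrow> c \<le> p \<bullet> q"
  by (auto simp: diam_le_def caps_def)

lemma diam_leI: "(\<And>p. p \<in> E \<Longrightarrow> norm p = 1) \<Longrightarrow> (\<And>p q. p \<in> E \<Longrightarrow> q \<in> E \<Longrightarrow> c \<le> p \<bullet> q) \<Longrightarrow> diam_le c E"
  by (auto simp: diam_le_def caps_def)

lemma diam_le_subset: "diam_le c E \<Longrightarrow> F \<subseteq> E \<Longrightarrow> diam_le c F"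
  by (auto simp: diam_le_def caps_def)

abbreviation diameters :: "real \<Rightarrow> (real^3) set \<Rightarrow> ((real^3) \<times> (real^3)) set" where
  "diameters c E \<equiv> {(p, q) \<in> E \<times> E. p \<bullet> q = c}"

text \<open>If \<open>m\<close> lies between \<open>a\<close> and \<open>b\<close> on the circle about \<open>x\<close>, then
  \<open>m = \<mu> a + \<nu> b - (\<mu> + \<nu> - 1) c x\<close> with \<open>\<mu> + \<nu> > 1\<close>, and taking the inner product with
  \<open>z\<close> forces \<open>x \<bullet> z = 1\<close>.\<close>

lemma middle_diameter_unique:
  assumes c: "0 < c" "c < 1" and E: "diam_le c E"
    and x: "x \<in> E" and y: "y1 \<in> E" "y2 \<in> E" "y3 \<in> E" "x \<bullet> y1 = c" "x \<bullet> y2 = c" "x \<bullet> y3 = c"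
    and ne: "y1 \<noteq> y2" "y2 \<noteq> y3" "y3 \<noteq> y1"
  obtains m where "m \<in> {y1, y2, y3}" "\<And>z. z \<in> E \<Longrightarrow> m \<bullet> z = c \<Longrightarrow> z = x"
proof -
  \<comment> \<open>Projection to the plane orthogonal to x. The partners of x share the component c
    along x, so their projections have equal length; their mutual angles are acute because y
    \<bullet> y' \<ge> c > c * c.\<close>
  define f where "f y = y - c *\<^sub>R x" for y
  have nx: "norm x = 1" using diam_leD E x by blast
  have fx: "x \<bullet> f y = 0" if "x \<bullet> y = c" for y using that nx by (simp add: f_def inner_diff_right norm_eq_1)
  have ff: "f y \<bullet> f y' = y \<bullet> y' - c\<^sup>2" if "x \<bullet> y = c" "x \<bullet> y' = c" for y y'
    using that nx by (simp add: f_def inner_diff_left inner_diff_right norm_eq_1 power2_eq_square inner_commute)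
  have fn: "norm (f y) = sqrt (1 - c\<^sup>2)" if "x \<bullet> y = c" "y \<in> E" for y
    using ff[of y y] that diam_leD(1)[OF E that(2)] by (simp add: norm_eq_sqrt_inner norm_eq_1)
  have c2: "c\<^sup>2 < c" using c by (simp add: power2_eq_square)
  have fp: "f y \<bullet> f y' > 0" if "x \<bullet> y = c" "x \<bullet> y' = c" "y \<in> E" "y' \<in> E" for y y'
    using ff that diam_leD(2)[OF E that(3,4)] c2 by simp
  have "x \<noteq> 0" using nx by auto
  then have "\<exists>m a b \<mu> \<nu>. {m, a, b} = {f y1, f y2, f y3} \<and> a \<noteq> b \<and> \<mu> > 0 \<and> \<nu> > 0 \<and> m = \<mu> *\<^sub>R a + \<nu> *\<^sub>R b"
    using ne y by (intro middle_of_three[where x = x and r = "sqrt (1 - c\<^sup>2)"] fx fn fp) (auto simp: f_def)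
  then obtain m' a' b' \<mu> \<nu> where m': "{m', a', b'} = f ` {y1, y2, y3}" "a' \<noteq> b'" "\<mu> > 0" "\<nu> > 0" "m' = \<mu> *\<^sub>R a' + \<nu> *\<^sub>R b'"
    by auto
  from m'(1) have "m' \<in> f ` {y1, y2, y3}" "a' \<in> f ` {y1, y2, y3}" "b' \<in> f ` {y1, y2, y3}" by blast+
  then obtain m a b where ab: "m' = f m" "a' = f a" "b' = f b" "{m, a, b} \<subseteq> {y1, y2, y3}" by blast
  then have abE: "m \<in> E" "a \<in> E" "b \<in> E" "x \<bullet> m = c" "x \<bullet> a = c" "x \<bullet> b = c" using y by auto
  have mid: "f m = \<mu> *\<^sub>R f a + \<nu> *\<^sub>R f b" using ab m' by simp
  define r where "r = sqrt (1 - c\<^sup>2)"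
  have r0: "r > 0" unfolding r_def using c c2 by simp
  have nf: "norm (f m) = r" "norm (f a) = r" "norm (f b) = r" using fn abE by (auto simp: r_def)
  \<comment> \<open>Equality in the triangle inequality would make the two outer projections equal;
    hence \<mu> + \<nu> > 1.\<close>
  have "r \<noteq> (\<mu> + \<nu>) * r"
  proof
    assume eq: "r = (\<mu> + \<nu>) * r"
    then have "norm (\<mu> *\<^sub>R f a + \<nu> *\<^sub>R f b) = norm (\<mu> *\<^sub>R f a) + norm (\<nu> *\<^sub>R f b)"
      using mid nf m' by (simp add: distrib_right)
    then have "(\<mu> * r * \<nu>) *\<^sub>R f b = (\<nu> * r * \<mu>) *\<^sub>R f a"
      unfolding norm_triangle_eq using nf m' by simp
    then have "f b = f a" using r0 m' by (simp add: ac_simps)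
    then show False using m'(2) ab by simp
  qed
  moreover have "r \<le> (\<mu> + \<nu>) * r"
    using norm_triangle_ineq[of "\<mu> *\<^sub>R f a" "\<nu> *\<^sub>R f b"] nf mid m' by (simp add: distrib_right)
  ultimately have s1: "\<mu> + \<nu> > 1" using r0 by (simp add: order_le_less)
  show ?thesis
  proof (rule that[of m])
    show "m \<in> {y1, y2, y3}" using ab by blast
    fix z assume z: "z \<in> E" "m \<bullet> z = c"
    have "m = \<mu> *\<^sub>R a + \<nu> *\<^sub>R b - ((\<mu> + \<nu> - 1) * c) *\<^sub>R x"
      using mid by (simp add: f_def algebra_simps)
    then have "c = \<mu> * (a \<bullet> z) + \<nu> * (b \<bullet> z) - (\<mu> + \<nu> - 1) * c * (x \<bullet> z)"
      using z by (simp add: inner_diff_left inner_add_left)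
    moreover have "\<mu> * c \<le> \<mu> * (a \<bullet> z)" "\<nu> * c \<le> \<nu> * (b \<bullet> z)"
      using diam_leD(2)[OF E] abE z m' by auto
    ultimately have "(\<mu> + \<nu> - 1) * c \<le> (\<mu> + \<nu> - 1) * c * (x \<bullet> z)"
      by (simp add: algebra_simps)
    then have "1 \<le> x \<bullet> z" using s1 c by simp
    then have "x \<bullet> z = 1" using inner_le_1[OF nx diam_leD(1)[OF E z(1)]] by simp
    then show "z = x" using inner_eq_1D[OF nx diam_leD(1)[OF E z(1)]] by simp
  qed
qed

text \<open>A point with at most one partner can be removed at the cost of two ordered pairs. If
  there is none, no point has three partners, since the middle one of three partners of x would have
  x as its only partner; then the count is a sum of degrees that are at most two.\<close>

lemma card_diameters_le:
  assumes c: "0 < c" "c < 1" and "finite E" "diam_le c E"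
  shows "card (diameters c E) \<le> 2 * card E"
  using assms(3,4)
proof (induction E rule: finite_psubset_induct)
  case (psubset E)
  define N where "N p = {q \<in> E. p \<bullet> q = c}" for p
  have fN: "finite (N p)" for p using psubset by (simp add: N_def)
  show ?case
  proof (cases "\<exists>p\<in>E. card (N p) \<le> 1")
    case True
    then obtain p where p: "p \<in> E" "card (N p) \<le> 1" by blast
    have "diameters c E \<subseteq> diameters c (E - {p}) \<union> ({p} \<times> N p) \<union> (N p \<times> {p})"
      by (auto simp: N_def inner_commute)
    moreover have "finite (diameters c (E - {p}))"
      by (rule finite_subset[of _ "E \<times> E"]) (use psubset in auto)
    ultimately have "card (diameters c E) \<le> card (diameters c (E - {p}) \<union> ({p} \<times> N p) \<union> (N p \<times> {p}))"
      using fN by (intro card_mono) auto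
    also have "\<dots> \<le> card (diameters c (E - {p})) + card ({p} \<times> N p) + card (N p \<times> {p})"
      by (meson add_le_mono card_Un_le le_refl order_trans)
    also have "\<dots> \<le> card (diameters c (E - {p})) + 2"
      using p by (simp add: card_cartesian_product)
    also have "\<dots> \<le> 2 * card (E - {p}) + 2"
      using psubset.IH[of "E - {p}"] p psubset.prems diam_le_subset[of c E "E - {p}"] by auto
    also have "\<dots> = 2 * card E"
      using p psubset by (metis card_Suc_Diff1 mult_Suc_right add.commute)
    finally show ?thesis .
  next
    case False
    have "card (N x) \<le> 2" if x: "x \<in> E" for x
    proof (rule ccontr)
      assume "\<not> card (N x) \<le> 2"
      then have "3 \<le> card (N x)" by simp
      then obtain S where "S \<subseteq> N x" "card S = 3" by (meson obtain_subset_with_card_n)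
      then obtain y1 y2 y3 where y: "{y1, y2, y3} \<subseteq> N x" "y1 \<noteq> y2" "y2 \<noteq> y3" "y3 \<noteq> y1"
        unfolding card_3_iff by blast
      then obtain m where m: "m \<in> {y1, y2, y3}" "\<And>z. z \<in> E \<Longrightarrow> m \<bullet> z = c \<Longrightarrow> z = x"
        using middle_diameter_unique[OF c psubset.prems x, of y1 y2 y3] by (auto simp: N_def)
      then have "N m \<subseteq> {x}" by (auto simp: N_def)
      then have "card (N m) \<le> 1" using card_mono[of "{x}" "N m"] by simp
      moreover have "m \<in> E" using m y by (auto simp: N_def)
      ultimately show False using False by blast
    qed
    then have "(\<Sum>p\<in>E. card (N p)) \<le> (\<Sum>p\<in>E. 2)" by (intro sum_mono) auto
    moreover have "diameters c E = (SIGMA p:E. N p)" by (auto simp: N_def)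
    ultimately show ?thesis using psubset.hyps(1) fN by simp
  qed
qed

definition verts :: "real \<Rightarrow> (real^3) set \<Rightarrow> (real^3) set" where
  "verts c E = {v \<in> caps c E. \<exists>e\<in>E. \<exists>e'\<in>E. e \<noteq> e' \<and> e \<bullet> v = c \<and> e' \<bullet> v = c}"

text \<open>Diameters are counted as ordered pairs: adding a vertex of the ball polygon creates at least
  four of them but raises the bound \<open>2 * card F\<close> only by two.\<close>

lemma finite_completion:
  assumes c: "0 < c" "c < 1" and "finite F" "diam_le c F"
  shows "\<exists>E. F \<subseteq> E \<and> finite E \<and> diam_le c E \<and> verts c E \<subseteq> E"
  using assms(3,4)
proof (induction "2 * card F - card (diameters c F)" arbitrary: F rule: less_induct)
  case less
  show ?case
  proof (cases "verts c F \<subseteq> F")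
    case True
    then show ?thesis using less.prems by blast
  next
    case False
    then obtain v e e' where v: "v \<in> caps c F" "v \<notin> F" "e \<in> F" "e' \<in> F" "e \<noteq> e'" "e \<bullet> v = c" "e' \<bullet> v = c"
      by (auto simp: verts_def)
    define F' where "F' = insert v F"
    have vv: "v \<bullet> v = 1" using capsD(1)[OF v(1)] by (simp add: norm_eq_1)
    have dF': "diam_le c F'"
    proof (rule diam_leI)
      show "norm p = 1" if "p \<in> F'" for p
        using that diam_leD(1)[OF less.prems(2)] capsD(1)[OF v(1)] by (auto simp: F'_def)
      have vF: "c \<le> p \<bullet> v" if "p \<in> F" for p using capsD(2)[OF v(1) that] .
      show "c \<le> p \<bullet> q" if pq: "p \<in> F'" "q \<in> F'" for p q
      proof -
        consider "p \<in> F" "q \<in> F" | "p = v" "q = v" | "p = v" "q \<in> F" | "p \<in> F" "q = v"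
          using pq by (auto simp: F'_def)
        then show ?thesis
          by cases (use diam_leD(2)[OF less.prems(2)] vv c vF vF[of q] in \<open>simp_all add: inner_commute[of v q]\<close>)
      qed
    qed
    have fin: "finite F'" using less.prems by (simp add: F'_def)
    have sub: "diameters c F \<union> {(v, e), (v, e'), (e, v), (e', v)} \<subseteq> diameters c F'"
      using v by (auto simp: F'_def inner_commute)
    have finD: "finite (diameters c F')" "finite (diameters c F)"
      by (rule finite_subset[of _ "F' \<times> F'"], use fin in auto)
         (rule finite_subset[of _ "F \<times> F"], use less in auto)
    have "card (diameters c F \<union> {(v, e), (v, e'), (e, v), (e', v)}) = card (diameters c F) + card {(v, e), (v, e'), (e, v), (e', v)}"
      using finD(2) v(2) by (intro card_Un_disjoint) auto
    moreover have "card {(v, e), (v, e'), (e, v), (e', v)} = 4"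
    proof -
      have "e \<noteq> v" "e' \<noteq> v" using v by auto
      then show ?thesis using v(5) by (auto simp: card_insert_if)
    qed
    ultimately have "card (diameters c F) + 4 \<le> card (diameters c F')"
      using card_mono[OF finD(1) sub] by simp
    moreover have "card F' = card F + 1" using less.prems v(2) by (simp add: F'_def)
    \<comment> \<open>The subtraction in the measure is truncated at 0. This bound for the enlarged
      set is what makes the decrease strict.\<close>
    moreover have "card (diameters c F') \<le> 2 * card F'" using card_diameters_le[OF c fin dF'] .
    ultimately have "2 * card F' - card (diameters c F') < 2 * card F - card (diameters c F)" by simp
    from less.hyps[OF this fin dF'] show ?thesis unfolding F'_def by blast
  qed
qed

section \<open>Ball polygons\<close>

text \<open>A tangent direction t that strictly improves every active constraint is feasible for
  small steps, since the finitely many inactive ones survive by continuity. The optimality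
  conditions below are its contrapositives.\<close>

lemma ball_polygon_descent:
  assumes "finite E" and P: "P \<in> caps c E" and t: "P \<bullet> t = 0" "y \<bullet> t < 0"
    and act: "\<And>e. e \<in> E \<Longrightarrow> e \<bullet> P = c \<Longrightarrow> e \<bullet> t > 0"
  obtains P' where "P' \<in> caps c E" "y \<bullet> P' < y \<bullet> P"
proof -
  have n: "norm P = 1" using capsD(1)[OF P] .
  have "eventually (\<lambda>s. c \<le> e \<bullet> sgn (P + s *\<^sub>R t)) (at_right 0)" if e: "e \<in> E" for e
  proof (cases "e \<bullet> P = c")
    case True
    then show ?thesis using eventually_inner_sgn_greater[OF n t(1) act[OF e True]]
      by (auto elim: eventually_mono)
  next
    case False
    then have "c < e \<bullet> P" using capsD(2)[OF P e] by simp
    moreover have "((\<lambda>s. e \<bullet> sgn (P + s *\<^sub>R t)) \<longlongrightarrow> e \<bullet> P) (at_right 0)"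
      by (intro tendsto_intros tendsto_sgn_add n)
    ultimately have "eventually (\<lambda>s. c < e \<bullet> sgn (P + s *\<^sub>R t)) (at_right 0)"
      by (rule order_tendstoD(1)[rotated])
    then show ?thesis by (auto elim: eventually_mono)
  qed
  then have "eventually (\<lambda>s. \<forall>e\<in>E. c \<le> e \<bullet> sgn (P + s *\<^sub>R t)) (at_right 0)"
    using assms(1) by (intro eventually_ball_finite) auto
  with eventually_inner_sgn_less[OF n t]
  have "eventually (\<lambda>s. y \<bullet> sgn (P + s *\<^sub>R t) < y \<bullet> P \<and> (\<forall>e\<in>E. c \<le> e \<bullet> sgn (P + s *\<^sub>R t))) (at_right 0)"
    by eventually_elim auto
  then obtain s where s: "y \<bullet> sgn (P + s *\<^sub>R t) < y \<bullet> P" "\<forall>e\<in>E. c \<le> e \<bullet> sgn (P + s *\<^sub>R t)"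
    using eventually_at_right_0D by blast
  have "P + s *\<^sub>R t \<noteq> 0" using norm_add_perp_ge_1[OF n t(1), of s] by auto
  then show ?thesis using that[of "sgn (P + s *\<^sub>R t)"] s by (auto simp: caps_def norm_sgn)
qed

text \<open>Here t is minus the tangential part of y at P; if it were nonzero, it would be a
  direction of descent.\<close>

lemma min_no_active:
  assumes "finite E" and P: "P \<in> caps c E" and min: "\<And>P'. P' \<in> caps c E \<Longrightarrow> y \<bullet> P \<le> y \<bullet> P'"
    and na: "\<And>e. e \<in> E \<Longrightarrow> e \<bullet> P \<noteq> c"
  shows "y = (y \<bullet> P) *\<^sub>R P"
proof (rule ccontr)
  assume ne: "y \<noteq> (y \<bullet> P) *\<^sub>R P"
  have n: "P \<bullet> P = 1" using capsD(1)[OF P] by (simp add: norm_eq_1)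
  define t where "t = (y \<bullet> P) *\<^sub>R P - y"
  have Pt: "P \<bullet> t = 0" using n by (simp add: t_def inner_diff_right inner_commute)
  have "t \<bullet> t > 0" using ne by (simp add: t_def)
  moreover have "t \<bullet> t = (y \<bullet> P) * (P \<bullet> t) - y \<bullet> t"
    by (subst (1) t_def) (simp add: inner_diff_left)
  ultimately have "y \<bullet> t < 0" using Pt by simp
  then obtain P' where "P' \<in> caps c E" "y \<bullet> P' < y \<bullet> P"
    using ball_polygon_descent[OF assms(1) P Pt] na by metis
  then show False using min[of P'] by simp
qed

text \<open>The Lagrange multiplier rule with one active constraint: m and k are the tangential
  parts of y and e at P, and m must be a nonnegative multiple of k.\<close>

lemma min_single_active:
  assumes "finite E" and P: "P \<in> caps c E" and min: "\<And>P'. P' \<in> caps c E \<Longrightarrow> y \<bullet> P \<le> y \<bullet> P'"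
    and c: "0 < c" "c < 1"
    and e: "e \<bullet> P = c" "norm e = 1" and single: "\<And>e'. e' \<in> E \<Longrightarrow> e' \<bullet> P = c \<Longrightarrow> e' = e"
  shows "\<exists>\<beta>\<ge>0. y - (y \<bullet> P) *\<^sub>R P = \<beta> *\<^sub>R (e - c *\<^sub>R P)"
proof -
  have n: "P \<bullet> P = 1" using capsD(1)[OF P] by (simp add: norm_eq_1)
  define k where "k = e - c *\<^sub>R P"
  define m where "m = y - (y \<bullet> P) *\<^sub>R P"
  have kP: "P \<bullet> k = 0" "P \<bullet> m = 0" using n e by (simp_all add: k_def m_def inner_diff_right inner_commute)
  have "c\<^sup>2 < 1" using c by (simp add: abs_square_less_1)
  moreover have "k \<bullet> k = 1 - c\<^sup>2" using e n
    by (simp add: k_def inner_diff_left inner_diff_right norm_eq_1 inner_commute power2_eq_square)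
  ultimately have k0: "norm k > 0" by auto
  show ?thesis
  proof (cases "k \<bullet> m = norm k * norm m")
    case True
    then have "norm k *\<^sub>R m = norm m *\<^sub>R k" using norm_cauchy_schwarz_eq by blast
    then have "(1 / norm k) *\<^sub>R (norm k *\<^sub>R m) = (1 / norm k) *\<^sub>R (norm m *\<^sub>R k)" by simp
    then have "m = (norm m / norm k) *\<^sub>R k" using k0 by simp
    then show ?thesis unfolding k_def m_def by (intro exI[of _ "norm m / norm k"]) (auto simp: k_def m_def)
  next
    case False
    then have lt: "k \<bullet> m < norm k * norm m" using norm_cauchy_schwarz[of k m] by simp
    then have m0: "norm m > 0" by (cases "m = 0") auto
    \<comment> \<open>Unless k and m point the same way, strict Cauchy-Schwarz makes this difference
      of rescaled vectors increase e and decrease y simultaneously.\<close>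
    define t where "t = norm m *\<^sub>R k - norm k *\<^sub>R m"
    have Pt: "P \<bullet> t = 0" using kP by (simp add: t_def inner_diff_right)
    have "e = k + c *\<^sub>R P" "y = m + (y \<bullet> P) *\<^sub>R P" by (simp_all add: k_def m_def)
    then have "e \<bullet> t = k \<bullet> t" "y \<bullet> t = m \<bullet> t" using Pt by (metis add.right_neutral inner_add_left inner_scaleR_left mult_zero_right)+
    moreover have "k \<bullet> t = norm k * (norm k * norm m - k \<bullet> m)"
      by (simp add: t_def inner_diff_right dot_square_norm power2_eq_square algebra_simps)
    moreover have "m \<bullet> t = - norm m * (norm k * norm m - k \<bullet> m)"
      by (simp add: t_def inner_diff_right dot_square_norm power2_eq_square algebra_simps inner_commute)
    ultimately have et: "e \<bullet> t > 0" and yt: "y \<bullet> t < 0" using lt k0 m0 by (simp_all add: mult_neg_pos)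
    obtain P' where "P' \<in> caps c E" "y \<bullet> P' < y \<bullet> P"
      using ball_polygon_descent[OF assms(1) P Pt yt] single et by metis
    then show ?thesis using min[of P'] by simp
  qed
qed

section \<open>Circles on the sphere and vertices on them\<close>

lemma orthonormal_frame:
  assumes "norm e = 1"
  obtains a b :: "real^3" where "norm a = 1" "norm b = 1" "e \<bullet> a = 0" "e \<bullet> b = 0" "a \<bullet> b = 0"
    "\<forall>x. x = (x \<bullet> e) *\<^sub>R e + (x \<bullet> a) *\<^sub>R a + (x \<bullet> b) *\<^sub>R b"
proof -
  obtain a where a: "norm a = 1" "e \<bullet> a = 0" by (rule perp_exists)
  define b where "b = cross3 e a"
  have ee: "e \<bullet> e = 1" "a \<bullet> a = 1" using assms a by (simp_all add: norm_eq_1)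
  have ab: "cross3 a b = e" using a ee by (simp add: b_def Lagrange inner_commute)
  have "cross3 e b = - a" using a ee by (simp add: b_def Lagrange)
  then have be: "cross3 b e = a" using cross_skew[of b e] by simp
  have "(norm b)\<^sup>2 = 1" using norm_cross[of e a] assms a by (simp add: b_def)
  then have "norm b = 1" using power2_eq_iff_nonneg[of "norm b" 1] by simp
  moreover have "x = (x \<bullet> e) *\<^sub>R e + (x \<bullet> a) *\<^sub>R a + (x \<bullet> b) *\<^sub>R b" for x
    using cramer_identity[of x a b e] ab be ee by (simp add: b_def)
  moreover have "e \<bullet> b = 0" "a \<bullet> b = 0" by (simp_all add: b_def dot_cross_self)
  ultimately show ?thesis using that a by blast
qed

definition circ :: "real^3 \<Rightarrow> real \<Rightarrow> (real^3) set" where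
  "circ e c = {v \<in> S2. e \<bullet> v = c}"

text \<open>Injectivity is stated on two half circles because the parametrisation closes up at
  2\<pi>, while an \<open>arc\<close> has to be injective including its endpoints.\<close>

lemma circle_param:
  assumes e: "norm e = 1" and c: "-1 < c" "c < 1"
  obtains g :: "real \<Rightarrow> real^3" where "continuous_on UNIV g" "g ` {0..2*pi} = circ e c" "inj_on g {0..pi}" "inj_on g {pi..2*pi}"
proof -
  obtain a b where ab: "norm a = 1" "norm b = 1" "e \<bullet> a = 0" "e \<bullet> b = 0" "a \<bullet> b = 0"
    "\<forall>x. x = (x \<bullet> e) *\<^sub>R e + (x \<bullet> a) *\<^sub>R a + (x \<bullet> b) *\<^sub>R b"
    by (rule orthonormal_frame[OF e])
  have dots: "e \<bullet> e = 1" "a \<bullet> a = 1" "b \<bullet> b = 1" "a \<bullet> e = 0" "b \<bullet> e = 0" "b \<bullet> a = 0"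
    using ab e by (simp_all add: norm_eq_1 inner_commute)
  have "\<bar>c\<bar> < 1" using c by auto
  then have c2: "c\<^sup>2 < 1" by (simp add: abs_square_less_1)
  define r where "r = sqrt (1 - c\<^sup>2)"
  have r: "r > 0" "r\<^sup>2 = 1 - c\<^sup>2" using c2 by (simp_all add: r_def)
  define g where "g t = c *\<^sub>R e + (r * cos t) *\<^sub>R a + (r * sin t) *\<^sub>R b" for t
  have ge: "e \<bullet> g t = c" "a \<bullet> g t = r * cos t" for t
    using ab dots by (simp_all add: g_def inner_add_right)
  have gn: "norm (g t) = 1" for t
  proof -
    have "g t \<bullet> g t = c\<^sup>2 + ((r * cos t)\<^sup>2 + (r * sin t)\<^sup>2)"
      using ab(1-5) dots by (simp add: g_def inner_add_left inner_add_right power2_eq_square)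
    also have "\<dots> = c\<^sup>2 + r\<^sup>2 * ((cos t)\<^sup>2 + (sin t)\<^sup>2)"
      by (simp only: power_mult_distrib distrib_left)
    finally show ?thesis using r by (simp add: norm_eq_1)
  qed
  have gimg: "g ` {0..2*pi} = circ e c"
  proof (intro equalityI subsetI)
    fix v assume "v \<in> circ e c"
    then have v: "v \<bullet> v = 1" "v \<bullet> e = c" by (auto simp: circ_def norm_eq_1 inner_commute)
    have "v \<bullet> v = v \<bullet> ((v \<bullet> e) *\<^sub>R e + (v \<bullet> a) *\<^sub>R a + (v \<bullet> b) *\<^sub>R b)" using ab(6)[rule_format, of v] by simp
    also have "\<dots> = c\<^sup>2 + (v \<bullet> a)\<^sup>2 + (v \<bullet> b)\<^sup>2" using v by (simp add: inner_add_right power2_eq_square)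
    finally have "(v \<bullet> a)\<^sup>2 + (v \<bullet> b)\<^sup>2 = r\<^sup>2" using v r by simp
    then have "(v \<bullet> a / r)\<^sup>2 + (v \<bullet> b / r)\<^sup>2 = 1" using r(1) by (simp add: power_divide flip: add_divide_distrib)
    then obtain t where t: "0 \<le> t" "t \<le> 2 * pi" "v \<bullet> a / r = cos t" "v \<bullet> b / r = sin t"
      using sincos_total_2pi_le by blast
    then have "v \<bullet> a = r * cos t" "v \<bullet> b = r * sin t" using r(1) by (simp_all add: field_simps)
    then have "v = g t" using ab(6)[rule_format, of v] v by (simp add: g_def)
    then show "v \<in> g ` {0..2*pi}" using t by simp
  qed (use ge gn in \<open>auto simp: circ_def\<close>)
  have gcont: "continuous_on UNIV g" unfolding g_def by (intro continuous_intros)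
  have gcos: "cos x = cos y" if "g x = g y" for x y
    using ge(2)[of x] ge(2)[of y] that r(1) by simp
  have "inj_on g {0..pi}"
  proof (rule inj_onI)
    fix x y assume xy: "x \<in> {0..pi}" "y \<in> {0..pi}" "g x = g y"
    show "x = y" using cos_inj_pi[OF _ _ _ _ gcos[OF xy(3)]] xy(1,2) by simp
  qed
  moreover have "inj_on g {pi..2*pi}"
  proof (rule inj_onI)
    fix x y assume xy: "x \<in> {pi..2*pi}" "y \<in> {pi..2*pi}" "g x = g y"
    have "cos (2 * pi - x) = cos (2 * pi - y)" using gcos[OF xy(3)] by (simp add: cos_diff)
    then have "2 * pi - x = 2 * pi - y" using cos_inj_pi[of "2 * pi - x" "2 * pi - y"] xy(1,2) by simp
    then show "x = y" by simp
  qed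
  ultimately show ?thesis by (intro that[OF gcont gimg])
qed

lemma connected_circ:
  assumes "norm e = 1" "-1 < c" "c < 1"
  shows "connected (circ e c)"
proof -
  obtain g :: "real \<Rightarrow> real^3" where "continuous_on UNIV g" "g ` {0..2*pi} = circ e c"
    using circle_param[OF assms] by metis
  then show ?thesis
    by (metis connected_Icc connected_continuous_image continuous_on_subset top_greatest)
qed

lemma closed_circ: "closed (circ e c)"
proof -
  have "circ e c = S2 \<inter> {v. e \<bullet> v = c}" by (auto simp: circ_def)
  then show ?thesis by (auto intro!: closed_Int closed_hyperplane)
qed

text \<open>Otherwise the part of the circle about \<open>e\<close> in the polygon is open and closed in that circle,
  hence all of it, although the point of the circle opposite to \<open>e2\<close> violates the constraint of
  \<open>e2\<close>.\<close>

lemma vertex_exists: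
  assumes c: "0 < c" "c < 1" and E: "finite E" "diam_le c E" and e: "e \<in> E" "e2 \<in> E" "e2 \<noteq> e"
    and P: "P \<in> caps c E" "e \<bullet> P = c"
  shows "\<exists>v\<in>verts c E. e \<bullet> v = c"
proof (rule ccontr)
  assume nv: "\<not> (\<exists>v\<in>verts c E. e \<bullet> v = c)"
  have ne: "norm e = 1" "norm e2 = 1" using diam_leD(1)[OF E(2)] e by auto
  define U where "U = circ e c \<inter> caps c E"
  \<comment> \<open>Without a vertex no second constraint is active on the circle, so open half
    spaces cut out the same set.\<close>
  have U: "U = circ e c \<inter> (\<Inter>e'\<in>E - {e}. {v. e' \<bullet> v > c})"
  proof (intro equalityI subsetI)
    fix v assume v: "v \<in> U"
    have "e' \<bullet> v > c" if "e' \<in> E - {e}" for e'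
    proof -
      have "e' \<bullet> v \<noteq> c" using nv v that e(1) by (auto simp: U_def verts_def circ_def)
      then show ?thesis using capsD(2)[of v c E e'] v that by (simp add: U_def)
    qed
    then show "v \<in> circ e c \<inter> (\<Inter>e'\<in>E - {e}. {v. e' \<bullet> v > c})" using v by (auto simp: U_def)
  next
    fix v assume v: "v \<in> circ e c \<inter> (\<Inter>e'\<in>E - {e}. {v. e' \<bullet> v > c})"
    then have "c \<le> e' \<bullet> v" if "e' \<in> E" for e'
      using that by (cases "e' = e") (auto simp: circ_def less_imp_le)
    then show "v \<in> U" using v by (auto simp: U_def caps_def circ_def)
  qed
  have "openin (top_of_set (circ e c)) U" unfolding U
    by (intro openin_open_Int open_INT) (use E in \<open>auto simp: open_halfspace_gt\<close>)
  moreover have "closedin (top_of_set (circ e c)) U" unfolding U_def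
    by (intro closedin_closed_Int compact_imp_closed compact_caps)
  moreover have "connected (circ e c)" using connected_circ[OF ne(1)] c by simp
  moreover have "P \<in> U" using P capsD(1)[OF P(1)] by (auto simp: U_def circ_def)
  ultimately have UA: "U = circ e c" unfolding connected_clopen by blast
  define k where "k = e \<bullet> e2"
  define m where "m = e2 - k *\<^sub>R e"
  define r where "r = sqrt (1 - c\<^sup>2)"
  have "c\<^sup>2 < 1" using c by (simp add: abs_square_less_1)
  then have r: "r > 0" "r\<^sup>2 = 1 - c\<^sup>2" by (simp_all add: r_def)
  have k1: "k \<le> 1" using inner_le_1 ne by (simp add: k_def)
  have dots: "e \<bullet> e = 1" "e2 \<bullet> e2 = 1" using ne by (simp_all add: norm_eq_1)
  have em: "e \<bullet> m = 0" "e2 \<bullet> m = m \<bullet> m"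
    using dots by (simp_all add: m_def k_def inner_diff_right inner_diff_left inner_commute)
  have "m \<noteq> 0"
  proof
    assume "m = 0"
    then have "e2 = k *\<^sub>R e" by (simp add: m_def)
    moreover from this have "k * k = 1" using dots by simp
    moreover have "k \<ge> c" using diam_leD(2)[OF E(2)] e by (simp add: k_def)
    ultimately show False using e(3) c by (metis less_le_trans less_asym mult_eq_1 mult_minus1 neg_0_less_iff_less scaleR_one square_eq_1_iff zero_less_one)
  qed
  then have nm: "norm m > 0" by simp
  \<comment> \<open>The point of the circle farthest from e2, opposite to the component m of e2
    orthogonal to e: here e2 \<bullet> v = c k - r |m| < c.\<close>
  define v where "v = c *\<^sub>R e - (r / norm m) *\<^sub>R m"
  have "v \<bullet> v = c\<^sup>2 + (r / norm m)\<^sup>2 * (m \<bullet> m)"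
    using em dots by (simp add: v_def inner_diff_left inner_diff_right inner_commute power2_eq_square)
  also have "\<dots> = 1" using nm r by (simp add: dot_square_norm power_divide)
  finally have "v \<in> circ e c" using em dots by (simp add: circ_def norm_eq_1 v_def inner_diff_right)
  then have "c \<le> e2 \<bullet> v" using UA capsD(2)[of v c E e2] e by (auto simp: U_def)
  moreover have "e2 \<bullet> v = c * k - r * norm m"
    using nm em by (simp add: v_def inner_diff_right k_def inner_commute dot_square_norm power2_eq_square)
  moreover have "r * norm m > 0" using r nm by simp
  moreover have "c * k \<le> c" using k1 c by simp
  ultimately show False by linarith
qed

lemma norm_strict_triangle:
  fixes P Q :: "'a::real_inner"
  assumes "norm P = 1" "norm Q = 1" "P \<noteq> Q" "a > 0" "b > 0"
  shows "norm (a *\<^sub>R P + b *\<^sub>R Q) < a + b"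
proof -
  have "norm (a *\<^sub>R P + b *\<^sub>R Q) \<noteq> norm (a *\<^sub>R P) + norm (b *\<^sub>R Q)"
    unfolding norm_triangle_eq using assms by (simp add: mult.commute)
  then show ?thesis using norm_triangle_ineq[of "a *\<^sub>R P" "b *\<^sub>R Q"] assms by simp
qed

text \<open>Suppose \<open>P\<close> is the point of the polygon farthest from \<open>Q\<close>, at distance more than
  \<open>arccos c\<close>. Then \<open>P\<close> is no vertex, so its only active centre \<open>e\<close> lies strictly between \<open>P\<close>
  and \<open>Q\<close>. Some vertex \<open>v\<close> has distance exactly \<open>arccos c\<close> from \<open>e\<close> and, being a centre itself,
  at most \<open>arccos c\<close> from \<open>P\<close> and \<open>Q\<close>, contradicting the strict convexity of balls.\<close>

lemma reuleaux_polygon_diameter: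
  assumes c: "0 < c" "c < 1" and E: "finite E" "diam_le c E" "verts c E \<subseteq> E" "e1 \<in> E" "e2 \<in> E" "e1 \<noteq> e2"
  shows "diam_le c (caps c E)"
proof (rule diam_leI)
  fix R Q assume R: "R \<in> caps c E" and Q: "Q \<in> caps c E"
  have nQ: "norm Q = 1" using capsD(1)[OF Q] .
  have "continuous_on (caps c E) (\<lambda>P. Q \<bullet> P)" by (intro continuous_intros)
  then obtain P where P: "P \<in> caps c E" and min: "\<And>P'. P' \<in> caps c E \<Longrightarrow> Q \<bullet> P \<le> Q \<bullet> P'"
    using continuous_attains_inf[OF compact_caps] R by (metis empty_iff)
  have nP: "norm P = 1" using capsD(1)[OF P] .
  have "c \<le> Q \<bullet> P"
  proof (rule ccontr)
    assume "\<not> c \<le> Q \<bullet> P"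
    then have lt: "Q \<bullet> P < c" by simp
    have PQ: "P \<noteq> Q" using lt c nP by (auto simp: norm_eq_1)
    have np: "Q \<noteq> (Q \<bullet> P) *\<^sub>R P"
    proof
      assume eq: "Q = (Q \<bullet> P) *\<^sub>R P"
      then have "\<bar>Q \<bullet> P\<bar> = 1" using nP nQ by (metis norm_scaleR mult_1_right)
      then have "Q \<bullet> P = -1" using lt c by auto
      then have "e1 \<bullet> Q = - (e1 \<bullet> P)" using eq by (metis inner_minus_right scaleR_minus1_left)
      then show False using capsD(2)[OF P E(4)] capsD(2)[OF Q E(4)] c by linarith
    qed
    then obtain e where e: "e \<in> E" "e \<bullet> P = c" using min_no_active[OF E(1) P min] by blast
    show False
    proof (cases "\<exists>e'\<in>E. e' \<noteq> e \<and> e' \<bullet> P = c")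
      case True
      then have "P \<in> verts c E" using P e by (auto simp: verts_def)
      then show False using E(3) capsD(2)[OF Q] lt by (force simp: inner_commute)
    next
      case False
      have ne: "norm e = 1" using diam_leD(1)[OF E(2) e(1)] .
      obtain \<beta> where \<beta>: "\<beta> \<ge> 0" "Q - (Q \<bullet> P) *\<^sub>R P = \<beta> *\<^sub>R (e - c *\<^sub>R P)"
        using min_single_active[OF E(1) P min c e(2) ne] False by blast
      have b0: "\<beta> > 0" using \<beta> np by (cases "\<beta> = 0") auto
      define m where "m = Q \<bullet> P"
      have dots: "P \<bullet> P = 1" "Q \<bullet> Q = 1" "e \<bullet> e = 1" "P \<bullet> Q = m" "P \<bullet> e = c"
        using nP nQ ne e(2) by (simp_all add: norm_eq_1 m_def inner_commute)
      have "(Q - m *\<^sub>R P) \<bullet> (Q - m *\<^sub>R P) = \<beta>\<^sup>2 * ((e - c *\<^sub>R P) \<bullet> (e - c *\<^sub>R P))"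
        using \<beta>(2) by (simp add: m_def power2_eq_square)
      then have sq: "1 - m\<^sup>2 = \<beta>\<^sup>2 * (1 - c\<^sup>2)"
        using dots e(2) by (simp add: inner_diff_left inner_diff_right inner_commute[of Q P] power2_eq_square)
      \<comment> \<open>The multiplier equation solved for e as a combination of P and Q.\<close>
      define a where "a = c - m / \<beta>"
      define b where "b = 1 / \<beta>"
      have bpos: "b > 0" using b0 by (simp add: b_def)
      \<comment> \<open>Only m > 0 needs work: then m < c in \<open>sq\<close> forces \<beta> > 1,
        hence m / \<beta> < c.\<close>
      have apos: "a > 0"
      proof (cases "m \<le> 0")
        case True
        then have "m / \<beta> \<le> 0" using b0 by (simp add: divide_le_0_iff)
        then show ?thesis using c by (simp add: a_def)
      next
        case False
        then have "m\<^sup>2 < c\<^sup>2" using lt by (simp add: m_def power_strict_mono)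
        moreover have "c\<^sup>2 < 1" using c by (simp add: abs_square_less_1)
        ultimately have "1 * (1 - c\<^sup>2) < \<beta>\<^sup>2 * (1 - c\<^sup>2)" unfolding sq[symmetric] by simp
        then have "1 < \<beta>\<^sup>2" using \<open>c\<^sup>2 < 1\<close> mult_right_less_imp_less[of 1 "1 - c\<^sup>2" "\<beta>\<^sup>2"] by simp
        then have "1 < \<beta>" using b0 by (metis one_power2 power2_less_imp_less less_imp_le)
        then have "m / \<beta> < m" using False by (simp add: divide_less_eq)
        then show ?thesis using lt by (simp add: a_def m_def)
      qed
      have "e = c *\<^sub>R P + b *\<^sub>R (\<beta> *\<^sub>R (e - c *\<^sub>R P))" using b0 by (simp add: b_def)
      also have "\<dots> = a *\<^sub>R P + b *\<^sub>R Q" unfolding \<beta>(2)[symmetric] m_def[symmetric]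
        by (simp add: a_def b_def scaleR_diff_right scaleR_diff_left)
      finally have ePQ: "e = a *\<^sub>R P + b *\<^sub>R Q" .
      have "1 < a + b" using norm_strict_triangle[OF nP nQ PQ apos bpos] ePQ ne by simp
      obtain e' where "e' \<in> E" "e' \<noteq> e" using E(4-6) by blast
      then obtain v where v: "v \<in> verts c E" "e \<bullet> v = c"
        using vertex_exists[OF c E(1,2) e(1) _ _ P e(2)] by blast
      then have "v \<in> E" using E(3) by blast
      then have "a * c + b * c \<le> a * (v \<bullet> P) + b * (v \<bullet> Q)"
        using capsD(2)[OF P] capsD(2)[OF Q] apos bpos by (intro add_mono mult_left_mono) auto
      also have "\<dots> = v \<bullet> e" unfolding ePQ by (simp add: inner_add_right)
      also have "\<dots> = c" using v(2) by (simp add: inner_commute)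
      finally have "(a + b) * c \<le> 1 * c" by (simp add: distrib_right)
      then show False using \<open>1 < a + b\<close> c by simp
    qed
  qed
  then show "c \<le> R \<bullet> Q" using min[OF R] by (simp add: inner_commute)
qed (use capsD in blast)

section \<open>Polars of Reuleaux polygons\<close>

text \<open>A unit vector a P + b Q on an arc has a + b \<ge> 1 by the triangle inequality, so lower
  bounds by c \<ge> 0 are inherited.\<close>

lemma caps_spherical_convex:
  assumes "c \<ge> 0" "norm q = 1" "\<And>x. x \<in> caps c X \<Longrightarrow> q \<bullet> x > 0"
  shows "spherical_convex (caps c X)"
  unfolding spherical_convex_def
proof (intro conjI ballI)
  show "hemispherical (caps c X)"
    using assms by (intro hemisphericalI[of _ q] caps_subset) auto
  fix P Q assume PQ: "P \<in> caps c X" "Q \<in> caps c X"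
  show "gc_arc P Q \<subseteq> caps c X"
  proof
    fix R assume "R \<in> gc_arc P Q"
    then obtain a b where R: "norm R = 1" "a \<ge> 0" "b \<ge> 0" "R = a *\<^sub>R P + b *\<^sub>R Q"
      by (auto simp: gc_arc_def)
    have "1 \<le> a + b"
      using norm_triangle_ineq[of "a *\<^sub>R P" "b *\<^sub>R Q"] R capsD(1)[OF PQ(1)] capsD(1)[OF PQ(2)] by simp
    have "c \<le> Y \<bullet> R" if Y: "Y \<in> X" for Y
    proof -
      have "c * 1 \<le> c * (a + b)" using assms(1) \<open>1 \<le> a + b\<close> by (intro mult_left_mono)
      also have "\<dots> = a * c + b * c" by (simp add: algebra_simps)
      also have "\<dots> \<le> a * (Y \<bullet> P) + b * (Y \<bullet> Q)"
        using capsD(2)[OF PQ(1) Y] capsD(2)[OF PQ(2) Y] R by (intro add_mono mult_left_mono)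
      finally show ?thesis by (simp add: R(4) inner_add_right)
    qed
    then show "R \<in> caps c X" using R by (simp add: caps_def)
  qed
qed

lemma sinterior_polarI:
  assumes "compact K" "norm x = 1" and K: "\<And>P. P \<in> K \<Longrightarrow> norm P = 1 \<and> P \<bullet> x > 0"
  shows "x \<in> sinterior (caps 0 K)"
proof -
  obtain \<eta> where \<eta>: "\<eta> > 0" "\<And>P. P \<in> K \<Longrightarrow> 0 + \<eta> \<le> x \<bullet> P"
    using uniform_margin[OF assms(1), of 0 x] K by (metis inner_commute)
  have "S2 \<inter> ball x \<eta> \<subseteq> caps 0 K"
  proof
    fix y assume y: "y \<in> S2 \<inter> ball x \<eta>"
    have "0 \<le> P \<bullet> y" if P: "P \<in> K" for P
    proof -
      have "\<bar>P \<bullet> (x - y)\<bar> \<le> norm P * norm (x - y)" by (rule Cauchy_Schwarz_ineq2)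
      also have "\<dots> < \<eta>" using y K[OF P] by (simp add: dist_norm)
      finally show ?thesis using \<eta>(2)[OF P] by (simp add: inner_diff_right inner_commute)
    qed
    then show "y \<in> caps 0 K" using y by (simp add: caps_def)
  qed
  moreover have "openin (top_of_set S2) (S2 \<inter> ball x \<eta>)" by (simp add: openin_open_Int)
  ultimately show ?thesis unfolding interior_of_def using assms(2) \<eta>(1) by auto
qed

lemma sboundary_polar:
  assumes K: "compact K" "K \<subseteq> S2"
  shows "sboundary (caps 0 K) = {x \<in> caps 0 K. \<exists>P\<in>K. P \<bullet> x = 0}"
proof (intro equalityI subsetI)
  fix x assume x: "x \<in> sboundary (caps 0 K)"
  have "closedin (top_of_set S2) (caps 0 K)"
    by (simp add: closedin_S2_iff compact_caps caps_subset)
  then have xD: "x \<in> caps 0 K" using x frontier_of_subset_closedin by blast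
  have "x \<notin> sinterior (caps 0 K)" using x by (simp add: frontier_of_def)
  then obtain P where "P \<in> K" "\<not> P \<bullet> x > 0"
    using sinterior_polarI[OF K(1), of x] capsD(1)[OF xD] K(2) by fastforce
  then show "x \<in> {x \<in> caps 0 K. \<exists>P\<in>K. P \<bullet> x = 0}"
    using xD capsD(2)[OF xD] by force
next
  fix x assume "x \<in> {x \<in> caps 0 K. \<exists>P\<in>K. P \<bullet> x = 0}"
  then obtain P where P: "x \<in> caps 0 K" "P \<in> K" "P \<bullet> x = 0" by blast
  have "caps 0 K \<subseteq> hemisphere P" using P(2) by (auto simp: caps_def hemisphere_def)
  then show "x \<in> sboundary (caps 0 K)" using P K(2) by (intro sboundaryI[of _ P]) auto
qed

text \<open>The vector x + u is at most |u| away from the sphere, so projecting it back at most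
  doubles the displacement.\<close>

lemma norm_diff_sgn_add_le:
  fixes x u :: "'a::real_inner"
  assumes "norm x = 1" "x + u \<noteq> 0"
  shows "norm (sgn (x + u) - x) \<le> 2 * norm u"
proof -
  define y where "y = x + u"
  have "y \<noteq> 0" using assms by (simp add: y_def)
  then have "norm y *\<^sub>R sgn y = y" by (simp add: sgn_div_norm)
  then have "y - sgn y = (norm y - 1) *\<^sub>R sgn y" by (simp add: scaleR_diff_left)
  then have "norm (y - sgn y) = \<bar>norm y - 1\<bar>" using assms by (simp add: norm_sgn y_def)
  also have "\<dots> \<le> norm u" using norm_triangle_ineq3[of y x] assms(1) by (simp add: y_def)
  finally have "norm (sgn y - y) \<le> norm u" by (simp add: norm_minus_commute)
  moreover have "norm (sgn y - x) \<le> norm (sgn y - y) + norm (y - x)"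
    using norm_triangle_ineq[of "sgn y - y" "y - x"] by simp
  ultimately show ?thesis by (simp add: y_def)
qed

text \<open>Tilting x past a contact centre P leaves the polar; \<open>pencil_support\<close> then
  pulls the point back along z until it is on the boundary again. A component of z along w, which is
  orthogonal to x and P, carries the new point off the great circle of x and P, hence away from
  x.\<close>

lemma sboundary_polar_not_isolated:
  assumes K: "compact K" "K \<subseteq> S2" and z0: "\<And>P. P \<in> K \<Longrightarrow> z0 \<bullet> P > 0"
    and x: "x \<in> sboundary (caps 0 K)" and "\<epsilon> > 0"
  obtains y where "y \<in> sboundary (caps 0 K)" "y \<noteq> x" "dist y x < \<epsilon>"
proof -
  note bd = sboundary_polar[OF K]
  obtain P where P: "x \<in> caps 0 K" "P \<in> K" "P \<bullet> x = 0" using x unfolding bd by blast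
  have nx: "norm x = 1" and nP: "norm P = 1" using capsD(1) P K(2) by auto
  define w where "w = cross3 x P"
  have "(norm w)\<^sup>2 = 1" using norm_cross[of x P] nx nP P(3) by (simp add: w_def inner_commute)
  then have nw: "norm w = 1" using power2_eq_iff_nonneg[of "norm w" 1] by simp
  have w: "w \<bullet> x = 0" "w \<bullet> P = 0" by (simp_all add: w_def dot_cross_self)
  obtain \<eta>0 where \<eta>0: "\<eta>0 > 0" "\<And>P. P \<in> K \<Longrightarrow> 0 + \<eta>0 \<le> z0 \<bullet> P"
    using uniform_margin[OF K(1), of 0 z0] z0 by metis
  \<comment> \<open>A direction without component along w is tilted by half of its margin; the other
    half remains as \<eta>.\<close>
  define z where "z = (if w \<bullet> z0 = 0 then z0 + (\<eta>0 / 2) *\<^sub>R w else z0)"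
  define \<eta> where "\<eta> = \<eta>0 / 2"
  have \<eta>pos: "\<eta> > 0" using \<eta>0 by (simp add: \<eta>_def)
  have wz: "w \<bullet> z \<noteq> 0" using \<eta>0(1) nw by (auto simp: z_def inner_add_right norm_eq_1)
  have z\<eta>: "\<eta> \<le> z \<bullet> P'" if "P' \<in> K" for P'
  proof -
    have "-1 \<le> w \<bullet> P'" using inner_ge_minus_1[OF nw] that K(2) by auto
    then have "- \<eta> \<le> \<eta> * (w \<bullet> P')" using mult_left_mono[of "-1" "w \<bullet> P'" \<eta>] \<eta>pos by simp
    then show ?thesis using \<eta>0(2)[OF that] \<eta>pos by (auto simp: z_def \<eta>_def inner_add_left)
  qed
  \<comment> \<open>With M \<le> t / \<eta> the displacement u has length at most t l = \<epsilon> /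
    4, and normalising at most doubles it.\<close>
  define l where "l = 1 + norm z / \<eta>"
  define t where "t = \<epsilon> / (4 * l)"
  have den: "l > 0" using \<eta>pos by (simp add: l_def add_pos_nonneg)
  then have tpos: "t > 0" using assms(5) by (simp add: t_def)
  have zpos: "z \<bullet> P' > 0" if "P' \<in> K" for P' using z\<eta>[OF that] \<eta>pos by linarith
  have Kne: "K \<noteq> {}" using P by auto
  obtain M P0 where M: "P0 \<in> K" "((x - t *\<^sub>R P) + M *\<^sub>R z) \<bullet> P0 = 0"
      "\<And>P'. P' \<in> K \<Longrightarrow> 0 \<le> ((x - t *\<^sub>R P) + M *\<^sub>R z) \<bullet> P'"
      "\<And>P'. P' \<in> K \<Longrightarrow> (x - t *\<^sub>R P) \<bullet> P' < 0 \<Longrightarrow> M > 0"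
    using pencil_support[OF K(1) Kne zpos] by metis
  have "(x - t *\<^sub>R P) \<bullet> P < 0" using P(3) nP tpos by (simp add: inner_diff_left norm_eq_1 inner_commute[of x P])
  then have Mpos: "M > 0" using M(4) P(2) by blast
  have "M * (z \<bullet> P0) = t * (P \<bullet> P0) - x \<bullet> P0" using M(2) by (simp add: inner_add_left inner_diff_left)
  also have "\<dots> \<le> t * 1 - 0"
    using capsD(2)[OF P(1) M(1)] inner_le_1[OF nP, of P0] M(1) K(2) tpos
    by (intro diff_mono mult_left_mono) (auto simp: inner_commute)
  finally have "M * (z \<bullet> P0) \<le> t" by simp
  moreover have "M * \<eta> \<le> M * (z \<bullet> P0)" using z\<eta>[OF M(1)] Mpos by simp
  ultimately have Mle: "M \<le> t / \<eta>" using \<eta>pos by (simp add: le_divide_eq)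
  define u where "u = M *\<^sub>R z - t *\<^sub>R P"
  define p where "p = x + u"
  have pM: "p = (x - t *\<^sub>R P) + M *\<^sub>R z" by (simp add: p_def u_def)
  have "w \<bullet> p = M * (w \<bullet> z)" using w by (simp add: pM inner_add_right inner_diff_right)
  then have wp: "w \<bullet> p \<noteq> 0" using wz Mpos by simp
  then have p0: "p \<noteq> 0" by auto
  have "norm u \<le> M * norm z + t" using norm_triangle_ineq4[of "M *\<^sub>R z" "t *\<^sub>R P"] Mpos tpos nP by (simp add: u_def)
  also have "\<dots> \<le> (t / \<eta>) * norm z + t" using mult_right_mono[OF Mle norm_ge_zero[of z]] by simp
  also have "\<dots> = t * l" by (simp add: l_def algebra_simps)
  also have "\<dots> = \<epsilon> / 4" using den by (simp add: t_def)
  finally have "norm (sgn p - x) < \<epsilon>"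
    using norm_diff_sgn_add_le[OF nx, of u] p0 assms(5) by (simp add: p_def)
  moreover have "sgn p \<noteq> x" using wp w p0 by (auto simp: inner_sgn dest: arg_cong[of _ _ "\<lambda>v. w \<bullet> v"])
  moreover have "sgn p \<in> caps 0 K"
    using M(3) p0 by (intro sgn_in_polar) (auto simp: pM inner_commute)
  moreover have "P0 \<bullet> sgn p = 0" using M(2) by (simp add: inner_sgn pM inner_commute)
  ultimately show ?thesis using that M(1) unfolding bd by (auto simp: dist_norm)
qed

text \<open>Here c and s are the cosine and sine of \<delta>. The assumption \<open>diamK\<close> is
  supplied by \<open>reuleaux_polygon_diameter\<close>, and q by closeness of the polar to C; it
  makes the polar hemispherical.\<close>

locale reuleaux_polygon =
  fixes c s :: real and E :: "(real^3) set" and q :: "real^3"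
  assumes c: "0 < c" "c < 1" and s: "0 < s" "s\<^sup>2 + c\<^sup>2 = 1"
    and finE: "finite E" and neE: "E \<noteq> {}" and diamE: "diam_le c E"
    and vertsE: "verts c E \<subseteq> E" and diamK: "diam_le c (caps c E)"
    and q: "norm q = 1" "\<And>x. x \<in> caps 0 (caps c E) \<Longrightarrow> q \<bullet> x > 0"
begin

abbreviation "K \<equiv> caps c E"
abbreviation "D \<equiv> caps 0 (caps c E)"

lemma EK: "E \<subseteq> K" using diamE by (simp add: diam_le_def)

lemma norm_scale_s: "norm ((1 / s) *\<^sub>R y) = norm y / s" for y :: "real^3"
  using s(1) by simp

text \<open>This is the point at distance \<pi>/2 from P on the great circle from P through e. It
  lies in the polar because Q \<bullet> e \<ge> c \<ge> c (Q \<bullet> P) for Q in K.\<close>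

lemma opposite_point:
  assumes "e \<in> K" "P \<in> K" "e \<bullet> P = c"
  shows "(1 / s) *\<^sub>R (e - c *\<^sub>R P) \<in> D" "P \<bullet> ((1 / s) *\<^sub>R (e - c *\<^sub>R P)) = 0"
proof -
  have dots: "e \<bullet> e = 1" "P \<bullet> P = 1" "P \<bullet> e = c" using capsD(1) assms by (auto simp: norm_eq_1 inner_commute)
  show "P \<bullet> ((1 / s) *\<^sub>R (e - c *\<^sub>R P)) = 0" using dots by (simp add: inner_diff_right)
  have "(e - c *\<^sub>R P) \<bullet> (e - c *\<^sub>R P) = s\<^sup>2"
    using dots assms(3) s(2) by (simp add: inner_diff_left inner_diff_right power2_eq_square)
  then have "norm (e - c *\<^sub>R P) = s" using s(1) by (simp add: norm_eq_sqrt_inner)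
  then have "norm ((1 / s) *\<^sub>R (e - c *\<^sub>R P)) = 1" unfolding norm_scale_s using s(1) by simp
  moreover have "0 \<le> Q \<bullet> ((1 / s) *\<^sub>R (e - c *\<^sub>R P))" if Q: "Q \<in> K" for Q
  proof -
    have "Q \<bullet> P \<le> 1" using inner_le_1 capsD(1) Q assms(2) by blast
    then have "c * (Q \<bullet> P) \<le> c * 1" using c by (intro mult_left_mono) auto
    moreover have "c \<le> Q \<bullet> e" using diam_leD(2)[OF diamK Q assms(1)] .
    ultimately show ?thesis using s(1) by (simp add: inner_diff_right)
  qed
  ultimately show "(1 / s) *\<^sub>R (e - c *\<^sub>R P) \<in> D"
    unfolding caps_def[of 0] mem_Collect_eq mem_sphere_0 by blast
qed

text \<open>P minimises the inner product with x over K, with value 0. So P is a vertex or has a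
  single active centre e, and then x is a positive multiple of e - c P, the factor 1 / s being fixed
  by unit length.\<close>

lemma support_classification:
  assumes x: "x \<in> D" and P: "P \<in> K" and Px: "P \<bullet> x = 0"
  obtains e where "e \<in> E" "e \<bullet> P = c" "P \<in> verts c E \<or> x = (1 / s) *\<^sub>R (e - c *\<^sub>R P)"
proof -
  have nx: "norm x = 1" using capsD(1)[OF x] .
  have xP: "x \<bullet> P = 0" using Px by (simp add: inner_commute)
  have min: "x \<bullet> P \<le> x \<bullet> P'" if "P' \<in> K" for P'
    using capsD(2)[OF x that] xP by (simp add: inner_commute)
  have "x \<noteq> (x \<bullet> P) *\<^sub>R P" using xP nx by auto
  then obtain e where e: "e \<in> E" "e \<bullet> P = c" using min_no_active[OF finE P min] by blast
  show ?thesis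
  proof (cases "\<exists>e'\<in>E. e' \<noteq> e \<and> e' \<bullet> P = c")
    case True
    then have "P \<in> verts c E" using P e by (auto simp: verts_def)
    then show ?thesis using that e by blast
  next
    case False
    have ne: "norm e = 1" using diam_leD(1)[OF diamE e(1)] .
    obtain \<beta> where \<beta>: "\<beta> \<ge> 0" "x = \<beta> *\<^sub>R (e - c *\<^sub>R P)"
      using min_single_active[OF finE P min c e(2) ne] False xP by auto
    have "e \<in> K" using e EK by blast
    then have "norm ((1 / s) *\<^sub>R (e - c *\<^sub>R P)) = 1"
      using capsD(1)[OF opposite_point(1)[OF _ P e(2)]] by blast
    then have "norm (e - c *\<^sub>R P) = s" unfolding norm_scale_s using s(1) by (simp add: divide_eq_1_iff)
    then have "\<beta> * s = 1" using \<beta> nx by simp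
    then have "\<beta> = 1 / s" using s(1) by (simp add: field_simps)
    then show ?thesis using that[OF e] \<beta>(2) by simp
  qed
qed

lemma D_body: "spherical_convex_body D"
  unfolding spherical_convex_body_def
proof (intro conjI)
  show "closedin (top_of_set S2) D" by (simp add: closedin_S2_iff compact_caps caps_subset)
  show "spherical_convex D" using q by (intro caps_spherical_convex) auto
  obtain e where e: "e \<in> E" using neE by blast
  have "e \<in> sinterior D"
    using e capsD c diam_leD(1)[OF diamE e]
    by (intro sinterior_polarI compact_caps) (auto simp: inner_commute intro: less_le_trans)
  then show "sinterior D \<noteq> {}" by blast
qed

text \<open>By \<open>bipolar\<close> all supporting centres lie in K, so none is farther than
  arccos c from P. An active centre e of P attains this distance, and it supports D by
  \<open>opposite_point\<close> with the roles of e and P exchanged.\<close>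

lemma D_constant_width: "constant_width D (pi - arccos c)"
  unfolding constant_width_def
proof (intro allI impI)
  obtain e0 where e0: "e0 \<in> E" using neE by blast
  have "spherical_convex K"
  proof (rule caps_spherical_convex)
    show "norm e0 = 1" using diam_leD(1)[OF diamE e0] .
    show "0 < e0 \<bullet> x" if "x \<in> K" for x using capsD(2)[OF that e0] c by simp
  qed (use c in auto)
  moreover have "K \<noteq> {}" using e0 EK by blast
  ultimately have bip: "caps 0 D \<subseteq> K" using bipolar[OF compact_caps] by blast
  have supp: "supporting P D \<longleftrightarrow> P \<in> caps 0 D \<and> (\<exists>x\<in>D. P \<bullet> x = 0)" for P
    by (rule supporting_iff[OF compact_caps caps_subset])
  fix P assume "supporting P D"
  then obtain x where P: "P \<in> K" and x: "x \<in> D" "P \<bullet> x = 0" using supp bip by blast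
  obtain e where e: "e \<in> E" "e \<bullet> P = c" using support_classification[OF x(1) P x(2)] by metis
  have eK: "e \<in> K" using e EK by blast
  have nP: "norm P = 1" using capsD(1)[OF P] .
  have Pe: "P \<bullet> e = c" using e by (simp add: inner_commute)
  have "e \<in> caps 0 D" using capsD(1)[OF eK] eK by (auto simp: caps_def inner_commute)
  then have "supporting e D" unfolding supp
    using opposite_point[OF P eK Pe] by blast
  moreover have "e \<noteq> P" "e \<noteq> - P" using Pe c nP by (auto simp: norm_eq_1)
  moreover have "P \<bullet> e \<le> P \<bullet> Q" if "supporting Q D" for Q
  proof -
    have "Q \<in> K" using that supp bip by blast
    then show ?thesis using diam_leD(2)[OF diamK P] Pe by simp
  qed
  ultimately show "width P D = pi - arccos c" using width_eq[of e D P] nP Pe by simp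
qed

text \<open>An edge point P of K with centre e corresponds to x = (e - c P) / s, at distance arccos
  s from e, with inverse P = (e - s x) / c. A vertex v instead contributes the whole face v
  \<bullet> x = 0.\<close>

lemma D_boundary:
  "sboundary D = (\<Union>e\<in>E. {x \<in> circ e s. (1 / c) *\<^sub>R (e - s *\<^sub>R x) \<in> K}) \<union> (\<Union>v\<in>verts c E. {x \<in> D. v \<bullet> x = 0})"
  (is "_ = ?A \<union> ?B")
proof -
  have bd: "sboundary D = {x \<in> D. \<exists>P\<in>K. P \<bullet> x = 0}"
    by (rule sboundary_polar[OF compact_caps caps_subset])
  show ?thesis unfolding bd
  proof (intro equalityI subsetI)
    fix x assume "x \<in> {x \<in> D. \<exists>P\<in>K. P \<bullet> x = 0}"
    then obtain P where x: "x \<in> D" and P: "P \<in> K" "P \<bullet> x = 0" by blast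
    obtain e where e: "e \<in> E" "e \<bullet> P = c" "P \<in> verts c E \<or> x = (1 / s) *\<^sub>R (e - c *\<^sub>R P)"
      using support_classification[OF x P] by metis
    show "x \<in> ?A \<union> ?B"
    proof (cases "P \<in> verts c E")
      case True
      then show ?thesis using x P by blast
    next
      case False
      then have xe: "x = (1 / s) *\<^sub>R (e - c *\<^sub>R P)" using e by blast
      have "e \<bullet> e = 1" using diam_leD(1)[OF diamE e(1)] by (simp add: norm_eq_1)
      then have "e \<bullet> x = (1 - c\<^sup>2) / s" using e(2) by (simp add: xe inner_diff_right power2_eq_square)
      also have "\<dots> = s" using s by (simp add: field_simps power2_eq_square)
      finally have "x \<in> circ e s" using capsD(1)[OF x] by (simp add: circ_def)
      moreover have "(1 / c) *\<^sub>R (e - s *\<^sub>R x) = P" using s c by (simp add: xe)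
      ultimately show ?thesis using e(1) P by blast
    qed
  next
    fix x assume "x \<in> ?A \<union> ?B"
    then show "x \<in> {x \<in> D. \<exists>P\<in>K. P \<bullet> x = 0}"
    proof
      assume "x \<in> ?A"
      then obtain e where e: "e \<in> E" "x \<in> circ e s" "(1 / c) *\<^sub>R (e - s *\<^sub>R x) \<in> K" by blast
      define P where "P = (1 / c) *\<^sub>R (e - s *\<^sub>R x)"
      have "e \<bullet> e = 1" using diam_leD(1)[OF diamE e(1)] by (simp add: norm_eq_1)
      moreover have ex: "e \<bullet> x = s" "x \<bullet> x = 1" using e by (simp_all add: circ_def norm_eq_1)
      ultimately have "e \<bullet> P = (1 - s\<^sup>2) / c" by (simp add: P_def inner_diff_right power2_eq_square)
      also have "\<dots> = c" using s c by (simp add: field_simps power2_eq_square)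
      finally have eP: "e \<bullet> P = c" .
      have xe: "x = (1 / s) *\<^sub>R (e - c *\<^sub>R P)" using c s by (simp add: P_def)
      have PK: "P \<in> K" using e by (simp add: P_def)
      have "e \<in> K" using e EK by blast
      then show ?thesis using opposite_point[OF _ PK eP] xe PK by auto
    qed (auto simp: verts_def)
  qed
qed

end

section \<open>Boundary arcs\<close>

text \<open>Between the neighbours of x in Z the closed set S agrees with the open set V, so it is
  clopen in that interval and fills it; closedness adds the endpoints.\<close>

lemma interval_between_exceptions:
  fixes S V Z :: "real set"
  assumes S: "closed S" and V: "open V" and SO: "S \<inter> {a..b} - Z \<subseteq> V" "V \<inter> {a..b} \<subseteq> S"
    and Z: "finite Z" "a \<in> Z" "b \<in> Z" and x: "x \<in> S" "a \<le> x" "x \<le> b" "x \<notin> Z"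
  obtains u v where "u \<in> Z" "v \<in> Z" "u < x" "x < v" "{u..v} \<subseteq> S" "{u<..<v} \<inter> Z = {}" "a \<le> u" "v \<le> b"
proof -
  define u where "u = Max {z \<in> Z. z < x}"
  define v where "v = Min {z \<in> Z. x < z}"
  have "a \<noteq> x" "b \<noteq> x" using x Z by auto
  then have ax: "a < x" and xb: "x < b" using x by auto
  have fin: "finite {z \<in> Z. z < x}" "finite {z \<in> Z. x < z}" using Z by auto
  have u: "u \<in> {z \<in> Z. z < x}" unfolding u_def using fin Z ax by (intro Max_in) auto
  have v: "v \<in> {z \<in> Z. x < z}" unfolding v_def using fin Z xb by (intro Min_in) auto
  have au: "a \<le> u" unfolding u_def using fin Z ax by (intro Max_ge) auto
  have vb: "v \<le> b" unfolding v_def using fin Z xb by (intro Min_le) auto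
  have noZ: "{u<..<v} \<inter> Z = {}"
  proof (rule ccontr)
    assume "{u<..<v} \<inter> Z \<noteq> {}"
    then obtain z where z: "u < z" "z < v" "z \<in> Z" by auto
    then have "z \<noteq> x" using x by auto
    then consider "z < x" | "x < z" by linarith
    then show False
    proof cases
      case 1
      then have "z \<le> u" unfolding u_def using fin z by (intro Max_ge) auto
      then show False using z by simp
    next
      case 2
      then have "v \<le> z" unfolding v_def using fin z by (intro Min_le) auto
      then show False using z by simp
    qed
  qed
  have eq: "{u<..<v} \<inter> S = {u<..<v} \<inter> V" using SO noZ au vb by force
  have "openin (top_of_set {u<..<v}) ({u<..<v} \<inter> S)" unfolding eq by (rule openin_open_Int[OF V])
  moreover have "closedin (top_of_set {u<..<v}) ({u<..<v} \<inter> S)" by (rule closedin_closed_Int[OF S])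
  moreover have "connected {u<..<v}" by simp
  moreover have "x \<in> {u<..<v} \<inter> S" using u v x by simp
  ultimately have "{u<..<v} \<inter> S = {u<..<v}" unfolding connected_clopen by blast
  then have "closure {u<..<v} \<subseteq> S" using S by (intro closure_minimal) auto
  then have "{u..v} \<subseteq> S" using u v by (simp add: closure_greaterThanLessThan)
  then show ?thesis using that u v noZ au vb by blast
qed

lemma circle_arc_image:
  fixes u v :: real
  assumes g: "continuous_on UNIV g" "inj_on g {u..v}" and uv: "u < v"
    and sub: "g ` {u..v} \<subseteq> scircle P \<rho>" and P: "P \<in> S2"
  shows "circle_arc \<rho> (g ` {u..v})"
proof -
  have img: "path_image (g \<circ> linepath u v) = g ` {u..v}"
    using uv by (simp add: path_image_compose closed_segment_eq_real_ivl)
  have "arc (g \<circ> linepath u v)"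
    unfolding arc_def
  proof
    show "path (g \<circ> linepath u v)"
      using g by (intro path_continuous_image) (auto intro: continuous_on_subset)
    have "linepath u v ` {0..1} = {u..v}"
      using path_image_linepath[of u v] uv by (simp add: path_image_def closed_segment_eq_real_ivl)
    then show "inj_on (g \<circ> linepath u v) {0..1}"
      using g(2) arc_linepath[of u v] uv by (intro comp_inj_on) (auto simp: arc_def)
  qed
  then show ?thesis unfolding circle_arc_def using img sub P by (intro bexI[of _ P] exI[of _ "g \<circ> linepath u v"]) auto
qed

text \<open>A differs from the relatively open set cut out by V only in points of N. Cutting the
  circle at N leaves pieces inside or outside A; M gathers the points of A at the cuts, some of
  which may be isolated.\<close>

lemma circle_part_arcs:
  assumes e: "norm e = 1" and s: "-1 < s" "s < 1" and A: "closed A" "A \<subseteq> circ e s"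
    and V: "open V" "A - N \<subseteq> V" "V \<inter> circ e s \<subseteq> A" and N: "finite N"
  obtains F M where "finite F" "\<forall>B\<in>F. circle_arc (arccos s) B" "finite M" "A = \<Union>F \<union> M"
proof -
  obtain g where g: "continuous_on UNIV g" "g ` {0..2*pi} = circ e s" "inj_on g {0..pi}" "inj_on g {pi..2*pi}"
    by (rule circle_param[OF e s])
  have gc: "g x \<in> circ e s" if "0 \<le> x" "x \<le> 2*pi" for x using g(2) that by auto
  \<comment> \<open>Cutting also at \<pi> keeps every piece within one half circle, where g is
    injective.\<close>
  define Z where "Z = {0, pi, 2*pi} \<union> ({0..pi} \<inter> g -` N) \<union> ({pi..2*pi} \<inter> g -` N)"
  have finZ: "finite Z" unfolding Z_def
    using finite_vimage_IntI[OF N g(3)] finite_vimage_IntI[OF N g(4)] by (simp add: Int_commute)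
  have Zsub: "Z \<subseteq> {0..2*pi}" by (auto simp: Z_def)
  define F where "F = {g ` {u..v} | u v. u \<in> Z \<and> v \<in> Z \<and> u < v \<and> {u..v} \<subseteq> g -` A \<and> {u<..<v} \<inter> Z = {}}"
  have "F \<subseteq> (\<lambda>(u, v). g ` {u..v}) ` (Z \<times> Z)" by (auto simp: F_def)
  then have "finite F" by (rule finite_subset) (use finZ in auto)
  moreover have "circle_arc (arccos s) B" if BF: "B \<in> F" for B
  proof -
    obtain u v where uv: "B = g ` {u..v}" "u \<in> Z" "v \<in> Z" "u < v" "{u..v} \<subseteq> g -` A" "{u<..<v} \<inter> Z = {}"
      using BF unfolding F_def by blast
    have "pi \<in> Z" by (simp add: Z_def)
    then have "pi \<notin> {u<..<v}" using uv(6) by blast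
    then have "{u..v} \<subseteq> {0..pi} \<or> {u..v} \<subseteq> {pi..2*pi}" using uv(2-4) Zsub by force
    then have "inj_on g {u..v}" using g(3,4) inj_on_subset by blast
    moreover have "circ e s \<subseteq> scircle e (arccos s)" by (auto simp: circ_def scircle_def sdist_def)
    then have "g ` {u..v} \<subseteq> scircle e (arccos s)" using uv(5) A(2) by blast
    ultimately show ?thesis unfolding uv(1) using g(1) uv(4) e by (intro circle_arc_image[of _ _ _ e]) auto
  qed
  moreover have "finite (A \<inter> g ` Z)" using finZ by simp
  moreover have "A = \<Union>F \<union> (A \<inter> g ` Z)"
  proof (intro equalityI subsetI)
    fix y assume y: "y \<in> A"
    then have "y \<in> g ` {0..2*pi}" using A(2) g(2) by blast
    then obtain x where x: "y = g x" "0 \<le> x" "x \<le> 2*pi" by auto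
    show "y \<in> \<Union>F \<union> (A \<inter> g ` Z)"
    proof (cases "x \<in> Z")
      case True
      then show ?thesis using x y by blast
    next
      case False
      have 1: "closed (g -` A)" "open (g -` V)" using g(1) A(1) V(1)
        by (simp_all add: continuous_closed_vimage continuous_open_vimage continuous_on_eq_continuous_at)
      have 2: "g -` A \<inter> {0..2*pi} - Z \<subseteq> g -` V"
      proof
        fix t assume t: "t \<in> g -` A \<inter> {0..2*pi} - Z"
        then have "g t \<notin> N" by (auto simp: Z_def)
        then show "t \<in> g -` V" using t V(2) by blast
      qed
      have 3: "g -` V \<inter> {0..2*pi} \<subseteq> g -` A" using V(3) gc by force
      have 4: "0 \<in> Z" "2*pi \<in> Z" by (auto simp: Z_def)
      have 5: "x \<in> g -` A" using y x by simp
      obtain u v where uv: "u \<in> Z" "v \<in> Z" "u < x" "x < v" "{u..v} \<subseteq> g -` A" "{u<..<v} \<inter> Z = {}"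
        using interval_between_exceptions[OF 1 2 3 finZ 4 5 x(2,3) False] by metis
      have "u < v" using uv by simp
      then have "g ` {u..v} \<in> F"
        unfolding F_def mem_Collect_eq using uv by (intro exI[of _ u] exI[of _ v] conjI refl)
      moreover have "y \<in> g ` {u..v}" unfolding x(1) using uv by (intro imageI) simp
      ultimately show ?thesis by blast
    qed
  qed (auto simp: F_def)
  ultimately show ?thesis by (intro that[of F "A \<inter> g ` Z"]) auto
qed

section \<open>Convex sets on a great circle\<close>

lemma cross_parallel:
  fixes x y v :: "real^3"
  assumes "norm v = 1" "v \<bullet> x = 0" "v \<bullet> y = 0"
  shows "cross3 x y = (v \<bullet> cross3 x y) *\<^sub>R v"
proof -
  have "cross3 v (cross3 x y) = 0" using assms by (simp add: Lagrange)
  then have "cross3 v (cross3 v (cross3 x y)) = 0" by simp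
  moreover have "v \<bullet> v = 1" using assms(1) by (simp add: norm_eq_1)
  ultimately show ?thesis using Lagrange[of v v "cross3 x y"] by simp
qed

lemma inner_cross_diff:
  fixes v q x y :: "real^3"
  shows "v \<bullet> cross3 q (a *\<^sub>R y - b *\<^sub>R x) = (v \<bullet> cross3 q y) * a - (v \<bullet> cross3 q x) * b"
  by (simp add: cross3_def inner_vec_def sum_3 vector_def algebra_simps)

lemma gc_segmentI:
  assumes X: "compact X" "spherical_convex X" and v: "norm v = 1" "\<And>x. x \<in> X \<Longrightarrow> v \<bullet> x = 0"
  shows "X = {} \<or> (\<exists>A. X = {A}) \<or> gc_segment X"
proof (rule ccontr)
  assume neg: "\<not> ?thesis"
  obtain q0 where q0: "\<And>x. x \<in> X \<Longrightarrow> q0 \<bullet> x > 0"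
    using X by (meson hemisphericalD spherical_convex_def)
  have XS: "X \<subseteq> S2" using X by (simp add: spherical_convex_def hemispherical_def)
  \<comment> \<open>Projecting to the plane of the great circle leaves inner products with X
    unchanged.\<close>
  define q where "q = q0 - (v \<bullet> q0) *\<^sub>R v"
  have vq: "v \<bullet> q = 0" using v(1) by (simp add: q_def inner_diff_right norm_eq_1)
  have q: "q \<bullet> x > 0" if "x \<in> X" for x using q0[OF that] v(2)[OF that] by (simp add: q_def inner_diff_left)
  \<comment> \<open>The tangent of the signed angle from q to x, oriented by v; it orders X along
    the great circle.\<close>
  define f where "f x = (v \<bullet> cross3 q x) / (q \<bullet> x)" for x
  have "f x = (cross3 v q \<bullet> x) / (q \<bullet> x)" for x
    by (simp only: f_def inner_commute[of v "cross3 q x"] cross_triple[of v q x])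
  moreover have "continuous_on X (\<lambda>x. (cross3 v q \<bullet> x) / (q \<bullet> x))"
    using q by (intro continuous_intros) force
  ultimately have cont: "continuous_on X f" by presburger
  have Xne: "X \<noteq> {}" using neg by blast
  \<comment> \<open>The subtraction formula for the sine in vector form; it ties the order given by
    f to the sign of v \<bullet> cross3 x y.\<close>
  have br: "(q \<bullet> q) * (v \<bullet> cross3 x y) = (v \<bullet> cross3 q y) * (q \<bullet> x) - (v \<bullet> cross3 q x) * (q \<bullet> y)"
    if "x \<in> X" "y \<in> X" for x y
  proof -
    have "cross3 q (cross3 y x) = (q \<bullet> x) *\<^sub>R y - (q \<bullet> y) *\<^sub>R x" by (rule Lagrange)
    then have "v \<bullet> cross3 q (cross3 q (cross3 y x)) = (v \<bullet> cross3 q y) * (q \<bullet> x) - (v \<bullet> cross3 q x) * (q \<bullet> y)"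
      by (simp only: inner_cross_diff)
    moreover have "cross3 y x = (v \<bullet> cross3 y x) *\<^sub>R v" using cross_parallel[OF v(1)] v(2) that by blast
    then have "q \<bullet> cross3 y x = 0" using vq by (metis inner_commute inner_scaleR_right mult_zero_right)
    then have "v \<bullet> cross3 q (cross3 q (cross3 y x)) = - ((q \<bullet> q) * (v \<bullet> cross3 y x))"
      by (simp add: Lagrange[of q q "cross3 y x"] inner_diff_right vq)
    ultimately show ?thesis using cross_skew[of x y] by simp
  qed
  have qq: "q \<bullet> q > 0" using q Xne by (metis ex_in_conv inner_gt_zero_iff inner_zero_left less_irrefl)
  have mono: "v \<bullet> cross3 x y \<ge> 0" if "x \<in> X" "y \<in> X" "f x \<le> f y" for x y
  proof -
    have "(v \<bullet> cross3 q x) * (q \<bullet> y) \<le> (v \<bullet> cross3 q y) * (q \<bullet> x)"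
      using that(3) q[OF that(1)] q[OF that(2)] by (simp add: f_def divide_le_eq pos_le_divide_eq)
    then have "(q \<bullet> q) * (v \<bullet> cross3 x y) \<ge> 0" using br[OF that(1,2)] by simp
    then show ?thesis using qq by (simp add: zero_le_mult_iff)
  qed
  obtain A where A: "A \<in> X" "\<And>x. x \<in> X \<Longrightarrow> f A \<le> f x" using continuous_attains_inf[OF X(1) Xne cont] by blast
  obtain B where B: "B \<in> X" "\<And>x. x \<in> X \<Longrightarrow> f x \<le> f B" using continuous_attains_sup[OF X(1) Xne cont] by blast
  have eqI: "x = y" if "x \<in> X" "y \<in> X" "v \<bullet> cross3 x y = 0" for x y
  proof -
    have n: "norm x = 1" "norm y = 1" using that XS by auto
    have "cross3 x y = 0" using cross_parallel[OF v(1) v(2)[OF that(1)] v(2)[OF that(2)]] that(3) by simp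
    then have "(x \<bullet> y)\<^sup>2 = 1" using norm_cross[of x y] n by simp
    then have "x \<bullet> y = 1 \<or> x \<bullet> y = -1" by (simp add: power2_eq_1_iff)
    moreover have "x \<noteq> - y" using q[OF that(1)] q[OF that(2)] by auto
    ultimately show ?thesis using inner_eq_1D inner_eq_minus_1D n by blast
  qed
  have AB: "A \<noteq> B"
  proof
    assume "A = B"
    then have fA: "f x = f A" if "x \<in> X" for x using A(2)[OF that] B(2)[OF that] by simp
    have "v \<bullet> cross3 x A = 0" if "x \<in> X" for x
      using mono[OF that A(1)] mono[OF A(1) that] fA[OF that] cross_skew[of A x] by simp
    then have "X = {A}" using eqI A(1) by blast
    then show False using neg by blast
  qed
  have pos: "v \<bullet> cross3 A B > 0" using mono[OF A(1) B(1)] A(2)[OF B(1)] eqI[OF A(1) B(1)] AB by force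
  have "X = gc_arc A B"
  proof (intro equalityI subsetI)
    fix x assume x: "x \<in> X"
    define d where "d = v \<bullet> cross3 A B"
    have "v \<bullet> ((x \<bullet> cross3 A B) *\<^sub>R v) = 0"
      unfolding cramer_identity[of v A B x, symmetric] using v(2) x A B by (simp add: inner_add_right)
    then have "(x \<bullet> cross3 A B) *\<^sub>R v = 0" using v(1) by auto
    then have "d *\<^sub>R x + (v \<bullet> cross3 B x) *\<^sub>R A + (v \<bullet> cross3 x A) *\<^sub>R B = 0"
      using cramer_identity[of v A B x] by (simp add: d_def)
    then have "d *\<^sub>R x = (v \<bullet> cross3 x B) *\<^sub>R A + (v \<bullet> cross3 A x) *\<^sub>R B"
      by (simp add: cross_skew[of x B] cross_skew[of A x] algebra_simps eq_neg_iff_add_eq_0 eq_diff_eq)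
    then have "(1 / d) *\<^sub>R (d *\<^sub>R x) = ((v \<bullet> cross3 x B) / d) *\<^sub>R A + ((v \<bullet> cross3 A x) / d) *\<^sub>R B"
      by (simp add: scaleR_add_right)
    then have "x = ((v \<bullet> cross3 x B) / d) *\<^sub>R A + ((v \<bullet> cross3 A x) / d) *\<^sub>R B"
      using pos by (simp add: d_def)
    moreover have "(v \<bullet> cross3 x B) / d \<ge> 0" "(v \<bullet> cross3 A x) / d \<ge> 0"
      using pos mono[OF x B(1) B(2)[OF x]] mono[OF A(1) x A(2)[OF x]] by (simp_all add: d_def)
    ultimately show "x \<in> gc_arc A B" unfolding gc_arc_def using x XS by blast
  next
    fix x assume "x \<in> gc_arc A B"
    then show "x \<in> X" using X(2) A(1) B(1) by (auto simp: spherical_convex_def)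
  qed
  moreover have "A \<noteq> - B" using q[OF A(1)] q[OF B(1)] by auto
  ultimately have "gc_segment X" unfolding gc_segment_def using A(1) B(1) XS AB by blast
  then show False using neg by blast
qed

lemma closed_circle_arc: "circle_arc \<rho> B \<Longrightarrow> closed B"
  unfolding circle_arc_def by (metis arc_imp_path closed_path_image)

context reuleaux_polygon
begin

text \<open>The map h sends a boundary point x back to its edge point P. On the circle it turns the
  constraint of e into an equality, so only the other centres matter, strictly so away from the
  finitely many preimages of vertices.\<close>

lemma arc_on_centre:
  assumes e: "e \<in> E"
  obtains F M where "finite F" "\<forall>B\<in>F. circle_arc (arccos s) B" "finite M"
    "{x \<in> circ e s. (1 / c) *\<^sub>R (e - s *\<^sub>R x) \<in> K} = \<Union>F \<union> M"
proof -
  have ne: "norm e = 1" using diam_leD(1)[OF diamE e] .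
  then have ee: "e \<bullet> e = 1" by (simp add: norm_eq_1)
  have s1: "-1 < s" "s < 1"
  proof -
    have "c\<^sup>2 > 0" using c by simp
    then have "s\<^sup>2 < 1\<^sup>2" using s(2) unfolding one_power2 by linarith
    then show "s < 1" by (rule power2_less_imp_less) simp
    show "-1 < s" using s by simp
  qed
  define h where "h x = (1 / c) *\<^sub>R (e - s *\<^sub>R x)" for x
  have conth: "continuous_on UNIV h" unfolding h_def by (intro continuous_intros)
  define A where "A = {x \<in> circ e s. h x \<in> K}"
  define V where "V = (\<Inter>e'\<in>E - {e}. {x. e' \<bullet> h x > c})"
  define N where "N = {x. h x \<in> verts c E}"
  have "A = circ e s \<inter> h -` K" by (auto simp: A_def)
  moreover have "closed (h -` K)"
    using conth by (intro continuous_closed_vimage compact_imp_closed compact_caps) (simp add: continuous_on_eq_continuous_at)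
  ultimately have clA: "closed A" using closed_circ by auto
  have eh: "e \<bullet> h x = c" if "x \<in> circ e s" for x
  proof -
    have "e \<bullet> h x = (1 - s\<^sup>2) / c" using that ee by (simp add: h_def circ_def inner_diff_right power2_eq_square)
    also have "\<dots> = c" using s c by (simp add: field_simps power2_eq_square)
    finally show ?thesis .
  qed
  have nh: "norm (h x) = 1" if x: "x \<in> circ e s" for x
  proof -
    have xs: "x \<bullet> x = 1" "e \<bullet> x = s" "x \<bullet> e = s" using x by (auto simp: circ_def norm_eq_1 inner_commute)
    have "(e - s *\<^sub>R x) \<bullet> (e - s *\<^sub>R x) = c\<^sup>2"
      using xs ee s(2) by (simp add: inner_diff_left inner_diff_right power2_eq_square)
    then have "norm (e - s *\<^sub>R x) = c" using c by (simp add: norm_eq_sqrt_inner)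
    moreover have "norm (h x) = norm (e - s *\<^sub>R x) / c" unfolding h_def using c by simp
    ultimately show ?thesis using c by simp
  qed
  have "open V" unfolding V_def
    by (intro open_INT ballI open_Collect_less continuous_intros conth) (use finE in auto)
  moreover have "A - N \<subseteq> V"
  proof
    fix x assume x: "x \<in> A - N"
    then have xc: "x \<in> circ e s" "h x \<in> K" "h x \<notin> verts c E" by (auto simp: A_def N_def)
    have "e' \<bullet> h x > c" if "e' \<in> E - {e}" for e'
    proof -
      have "e' \<bullet> h x \<noteq> c" using xc eh[OF xc(1)] that e by (auto simp: verts_def)
      then show ?thesis using capsD(2)[OF xc(2), of e'] that by simp
    qed
    then show "x \<in> V" by (simp add: V_def)
  qed
  moreover have "V \<inter> circ e s \<subseteq> A"
  proof
    fix x assume x: "x \<in> V \<inter> circ e s"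
    then have "c \<le> e' \<bullet> h x" if "e' \<in> E" for e'
      using that eh by (cases "e' = e") (auto simp: V_def less_imp_le)
    then show "x \<in> A" using x nh by (auto simp: A_def caps_def)
  qed
  moreover have "finite N"
  proof -
    have "inj h" unfolding h_def using c s by (auto simp: inj_def)
    then have "finite (h -` verts c E)" using finite_subset[OF vertsE finE] by (intro finite_vimageI)
    moreover have "N = h -` verts c E" by (auto simp: N_def)
    ultimately show ?thesis by simp
  qed
  ultimately show ?thesis
    using circle_part_arcs[OF ne s1 clA, of V N] that unfolding A_def h_def by blast
qed

text \<open>Adding -v to the centres makes the face itself a polar, so convexity comes from
  \<open>caps_spherical_convex\<close>.\<close>

lemma face_segment:
  assumes "v \<in> K"
  shows "{x \<in> D. v \<bullet> x = 0} = {} \<or> (\<exists>A. {x \<in> D. v \<bullet> x = 0} = {A}) \<or> gc_segment {x \<in> D. v \<bullet> x = 0}"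
proof (rule gc_segmentI)
  have nv: "norm v = 1" using capsD(1)[OF assms] .
  have "{x \<in> D. v \<bullet> x = 0} = D \<inter> {x. v \<bullet> x = 0}" by auto
  then show "compact {x \<in> D. v \<bullet> x = 0}" by (simp add: compact_Int_closed compact_caps closed_hyperplane)
  have eq: "{x \<in> D. v \<bullet> x = 0} = caps 0 (insert (-v) K)"
    using assms by (auto simp: caps_def)
  show "spherical_convex {x \<in> D. v \<bullet> x = 0}" unfolding eq
    using q caps_antimono[of K "insert (-v) K" 0] by (intro caps_spherical_convex[of _ q]) auto
  show "norm v = 1" by (rule nv)
qed simp

text \<open>The pieces in \<open>D_boundary\<close> are arcs and segments, with union the closed set
  \<Union>H, together with a finite set N. A point of N outside \<Union>H would be isolated in the
  boundary, which \<open>sboundary_polar_not_isolated\<close> forbids.\<close>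

lemma D_boundary_of_arcs: "boundary_of_arcs (arccos s) D"
proof -
  define A where "A e = {x \<in> circ e s. (1 / c) *\<^sub>R (e - s *\<^sub>R x) \<in> K}" for e
  define X where "X v = {x \<in> D. v \<bullet> x = 0}" for v
  have "\<exists>F M. finite F \<and> (\<forall>B\<in>F. circle_arc (arccos s) B) \<and> finite M \<and> A e = \<Union>F \<union> M" if eE: "e \<in> E" for e
  proof -
    obtain F M where "finite F" "\<forall>B\<in>F. circle_arc (arccos s) B" "finite M" "A e = \<Union>F \<union> M"
      by (rule arc_on_centre[OF eE, folded A_def])
    then show ?thesis by (intro exI[of _ F] exI[of _ M]) simp
  qed
  then obtain F M where FM: "\<And>e. e \<in> E \<Longrightarrow> finite (F e) \<and> (\<forall>B\<in>F e. circle_arc (arccos s) B) \<and> finite (M e) \<and> A e = \<Union>(F e) \<union> M e"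
    by metis
  define G where "G = {X v |v. v \<in> verts c E \<and> gc_segment (X v)}"
  define N where "N = (\<Union>e\<in>E. M e) \<union> (\<Union>v\<in>{v \<in> verts c E. finite (X v)}. X v)"
  define H where "H = (\<Union>e\<in>E. F e) \<union> G"
  have finv: "finite (verts c E)" using finite_subset[OF vertsE finE] .
  have finH: "finite H" unfolding H_def G_def using FM finE finv by auto
  have finN: "finite N" unfolding N_def using FM finE finv by auto
  have arcs: "\<forall>B\<in>H. circle_arc (arccos s) B \<or> gc_segment B" using FM by (auto simp: H_def G_def)
  have bd: "sboundary D = (\<Union>e\<in>E. A e) \<union> (\<Union>v\<in>verts c E. X v)" using D_boundary by (simp add: A_def X_def)
  have Xv: "X v \<subseteq> \<Union>G \<union> N" if v: "v \<in> verts c E" for v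
  proof -
    have "v \<in> K" using v by (simp add: verts_def)
    then have "finite (X v) \<or> gc_segment (X v)" using face_segment[of v] unfolding X_def[symmetric] by (metis finite.emptyI finite_insert)
    then show ?thesis using v by (auto simp: G_def N_def)
  qed
  have HN: "sboundary D = \<Union>H \<union> N"
  proof (intro equalityI)
    have "A e \<subseteq> \<Union>H \<union> N" if "e \<in> E" for e
      using FM[OF that] that unfolding H_def N_def by blast
    moreover have "X v \<subseteq> \<Union>H \<union> N" if "v \<in> verts c E" for v
      using Xv[OF that] unfolding H_def by blast
    ultimately show "sboundary D \<subseteq> \<Union>H \<union> N" unfolding bd by blast
    have FA: "\<Union>(F e) \<subseteq> A e" "M e \<subseteq> A e" if "e \<in> E" for e
      using FM[OF that] by simp_all
    have "\<Union>(\<Union>e\<in>E. F e) \<subseteq> (\<Union>e\<in>E. A e)" using FA(1) by (intro Union_least) blast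
    moreover have "(\<Union>e\<in>E. M e) \<subseteq> (\<Union>e\<in>E. A e)" using FA(2) by (rule UN_mono[OF order_refl])
    moreover have "(\<Union>v\<in>{v \<in> verts c E. finite (X v)}. X v) \<subseteq> (\<Union>v\<in>verts c E. X v)" by blast
    moreover have "\<Union>G \<subseteq> (\<Union>v\<in>verts c E. X v)" unfolding G_def by blast
    ultimately show "\<Union>H \<union> N \<subseteq> sboundary D"
      unfolding bd H_def N_def Union_Un_distrib by (intro Un_least) (simp_all add: le_supI1 le_supI2)
  qed
  have "closed B" if "B \<in> H" for B
  proof (cases "B \<in> G")
    case True
    then obtain v where "B = D \<inter> {x. v \<bullet> x = 0}" by (auto simp: G_def X_def)
    then show ?thesis by (auto intro!: closed_Int closed_hyperplane compact_imp_closed compact_caps)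
  next
    case False
    then obtain e where "e \<in> E" "B \<in> F e" using \<open>B \<in> H\<close> by (auto simp: H_def)
    then show ?thesis using FM closed_circle_arc by blast
  qed
  then have clH: "closed (\<Union>H)" using finH by (intro closed_Union) auto
  have "N \<subseteq> \<Union>H"
  proof
    fix x assume xN: "x \<in> N"
    show "x \<in> \<Union>H"
    proof (rule ccontr)
      assume nx: "x \<notin> \<Union>H"
      have "closed (\<Union>H \<union> (N - {x}))" using clH finN by (simp add: closed_Un finite_imp_closed)
      then have "open (- (\<Union>H \<union> (N - {x})))" by (rule open_Compl)
      moreover have "x \<in> - (\<Union>H \<union> (N - {x}))" using nx by simp
      ultimately obtain \<epsilon> where \<epsilon>: "\<epsilon> > 0" "\<And>y. dist y x < \<epsilon> \<Longrightarrow> y \<in> - (\<Union>H \<union> (N - {x}))"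
        unfolding open_dist by blast
      obtain e where e: "e \<in> E" using neE by blast
      have xb: "x \<in> sboundary D" using xN HN by blast
      have pos: "0 < e \<bullet> P" if "P \<in> K" for P using capsD(2)[OF that e] c by simp
      obtain y where "y \<in> sboundary D" "y \<noteq> x" "dist y x < \<epsilon>"
        using sboundary_polar_not_isolated[OF compact_caps caps_subset pos xb \<epsilon>(1)] by metis
      then show False using \<epsilon>(2) HN by blast
    qed
  qed
  then have "sboundary D = \<Union>H" using HN by blast
  then show ?thesis unfolding boundary_of_arcs_def using finH arcs by blast
qed

end

section \<open>Approximation\<close>

text \<open>If x misses the constraints by \<epsilon> and z meets them with slack \<eta>, adding t z
  with t = \<epsilon> / \<eta> balances the two: (c - \<epsilon>) + t (c + \<eta>) = c (1 + t), and
  1 + t bounds the norm.\<close>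

lemma push_into_caps:
  assumes "c \<ge> 0" and x: "norm x = 1" and z: "norm z = 1" and e: "0 \<le> \<epsilon>" "\<epsilon> < \<eta>"
    and A: "\<And>P. P \<in> A \<Longrightarrow> c - \<epsilon> \<le> P \<bullet> x" "\<And>P. P \<in> A \<Longrightarrow> c + \<eta> \<le> P \<bullet> z"
  obtains x' where "x' \<in> caps c A" "norm (x' - x) \<le> 2 * (\<epsilon> / \<eta>)"
proof -
  define t where "t = \<epsilon> / \<eta>"
  have t: "0 \<le> t" "t < 1" "t * \<eta> = \<epsilon>" using e by (auto simp: t_def)
  have ge: "1 - t \<le> norm (x + t *\<^sub>R z)"
    using norm_triangle_ineq2[of x "- (t *\<^sub>R z)"] x z t by simp
  then have p0: "x + t *\<^sub>R z \<noteq> 0" using t by auto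
  have le: "norm (x + t *\<^sub>R z) \<le> 1 + t"
    using norm_triangle_ineq[of x "t *\<^sub>R z"] x z t by simp
  have "sgn (x + t *\<^sub>R z) \<in> caps c A"
  proof (rule sgn_in_caps[OF p0])
    fix P assume P: "P \<in> A"
    have "c * norm (x + t *\<^sub>R z) \<le> c * (1 + t)" using le assms(1) by (rule mult_left_mono)
    also have "\<dots> = (c - \<epsilon>) + t * (c + \<eta>)" using t(3) by (simp add: algebra_simps)
    also have "\<dots> \<le> P \<bullet> x + t * (P \<bullet> z)" using A[OF P] t(1) by (intro add_mono mult_left_mono)
    also have "\<dots> = P \<bullet> (x + t *\<^sub>R z)" by (simp add: inner_add_right)
    finally show "c * norm (x + t *\<^sub>R z) \<le> P \<bullet> (x + t *\<^sub>R z)" .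
  qed
  moreover have "norm (sgn (x + t *\<^sub>R z) - x) \<le> 2 * t"
    using norm_diff_sgn_add_le[OF x p0] z t by simp
  ultimately show ?thesis using that by (simp add: t_def)
qed

lemma inner_perturb:
  fixes x y z :: "'a::real_inner"
  assumes "norm z = 1" shows "y \<bullet> z - norm (x - y) \<le> x \<bullet> z"
proof -
  have "\<bar>(x - y) \<bullet> z\<bar> \<le> norm (x - y) * norm z" by (rule Cauchy_Schwarz_ineq2)
  then show ?thesis using assms by (simp add: inner_diff_left)
qed

lemma net_caps_bound:
  assumes "K \<subseteq> (\<Union>f\<in>F. ball f \<epsilon>)" "x \<in> caps c F" "P \<in> K"
  shows "c - \<epsilon> \<le> P \<bullet> x"
proof -
  obtain f where f: "f \<in> F" "norm (P - f) < \<epsilon>"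
    using assms by (auto simp: dist_norm norm_minus_commute)
  have "c \<le> f \<bullet> x" using capsD(2)[OF assms(2) f(1)] .
  then show ?thesis using inner_perturb[OF capsD(1)[OF assms(2)], of f P] f(2) by simp
qed

text \<open>Because the completed E may leave K, only F \<subseteq> E is used: it puts D and K' into
  the caps of the net, which \<open>push_into_caps\<close> compares with C and K. Closeness of K' to
  K then gives the remaining direction, from C to D.\<close>

lemma reuleaux_approximation:
  fixes \<tau> r :: real and C :: "(real^3) set"
  assumes \<tau>: "\<tau> > pi / 2" and C: "spherical_convex_body C" "constant_width C \<tau>"
    and r: "0 < r" "r < 1"
  shows "\<exists>D. spherical_convex_body D \<and> constant_width D \<tau> \<and> boundary_of_arcs (\<tau> - pi / 2) D
    \<and> (\<forall>x\<in>D. \<exists>y\<in>C. norm (x - y) \<le> r) \<and> (\<forall>y\<in>C. \<exists>x\<in>D. norm (x - y) \<le> r)"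
proof -
  define c where "c = cos (pi - \<tau>)"
  define s where "s = sin \<tau>"
  note CB = spherical_convex_bodyD[OF C(1)]
  note cw = constant_width_csupp[OF \<tau> C, folded c_def]
  have c: "0 < c" "c < 1" and \<tau>pi: "\<tau> < pi" using cw by auto
  have s: "0 < s" "s\<^sup>2 + c\<^sup>2 = 1" using \<tau> \<tau>pi pi_gt_zero by (auto simp: s_def c_def sin_gt_zero cos_diff)
  have "s = cos (\<tau> - pi / 2)" by (simp add: s_def cos_diff)
  then have arc_s: "arccos s = \<tau> - pi / 2" using \<tau> \<tau>pi by (simp add: arccos_cos)
  have arc_c: "pi - arccos c = \<tau>" using \<tau> \<tau>pi pi_gt_zero unfolding c_def by (subst arccos_cos) auto
  define K where "K = caps 0 C"
  have dia: "diam_le c K"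
    using polar_diameter[OF \<tau> C, folded c_def K_def] by (intro diam_leI) (auto simp: K_def capsD)
  have complete: "caps c K \<subseteq> K" using polar_complete[OF \<tau> C, folded c_def K_def] .
  have polK: "caps 0 K \<subseteq> C" unfolding K_def by (rule bipolar[OF CB(1,4,3)])
  have cK: "compact K" unfolding K_def by (rule compact_caps)
  obtain q where q: "norm q = 1" "\<And>x. x \<in> C \<Longrightarrow> q \<bullet> x > 0"
    using CB(4) by (meson hemisphericalD spherical_convex_def)
  obtain \<eta>1 where \<eta>1: "\<eta>1 > 0" "\<And>x. x \<in> C \<Longrightarrow> 0 + \<eta>1 \<le> q \<bullet> x" using uniform_margin[OF CB(1) q(2)] by metis
  have qK: "q \<in> K" using q less_imp_le by (auto simp: caps_def inner_commute K_def)
  obtain z where z: "z \<in> sinterior C" using C(1) by (auto simp: spherical_convex_body_def)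
  have zC: "z \<in> C" using z interior_of_subset by fast
  have nz: "norm z = 1" using zC CB(2) by auto
  have "z \<bullet> P > 0" if "P \<in> K" for P using sinterior_pos[OF z _ CB(2)] that by (simp add: K_def inner_commute)
  then obtain \<eta>2 where \<eta>2: "\<eta>2 > 0" "\<And>P. P \<in> K \<Longrightarrow> 0 + \<eta>2 \<le> z \<bullet> P" using uniform_margin[OF cK] by metis
  have \<eta>11: "\<eta>1 \<le> 1"
    using \<eta>1(2)[OF zC] inner_le_1[OF q(1) nz] by simp
  \<comment> \<open>The ball constraints need a push target with slack. If q \<bullet> Q = c, then q
    - \<eta>1 Q would still be nonnegative on C, and its direction would be a point of K too far
    from Q.\<close>
  have "q \<bullet> Q > c" if Q: "Q \<in> K" for Q
  proof (rule ccontr)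
    assume "\<not> q \<bullet> Q > c"
    then have qQ: "q \<bullet> Q = c" using diam_leD(2)[OF dia qK Q] by simp
    have nQ: "norm Q = 1" using diam_leD(1)[OF dia Q] .
    define p where "p = q - \<eta>1 *\<^sub>R Q"
    have "q \<bullet> p = 1 - \<eta>1 * c" using q(1) qQ by (simp add: p_def inner_diff_right norm_eq_1)
    moreover have "q \<bullet> p \<le> norm p" using norm_cauchy_schwarz[of q p] q(1) by simp
    ultimately have np: "1 - \<eta>1 * c \<le> norm p" by simp
    have "\<eta>1 * c < 1" using mult_right_mono[OF \<eta>11, of c] c by linarith
    then have p0: "p \<noteq> 0" using np by auto
    have "0 \<le> x \<bullet> p" if x: "x \<in> C" for x
    proof -
      have "x \<bullet> Q \<le> 1" using inner_le_1[OF _ nQ] CB(2) x by auto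
      then have "\<eta>1 * (x \<bullet> Q) \<le> \<eta>1" using \<eta>1(1) by simp
      then show ?thesis using \<eta>1(2)[OF x] by (simp add: p_def inner_diff_right inner_commute)
    qed
    then have "sgn p \<in> K" unfolding K_def by (rule sgn_in_polar[OF p0])
    then have "c \<le> Q \<bullet> sgn p" using diam_leD(2)[OF dia Q] by blast
    then have "c * norm p \<le> Q \<bullet> p" using p0 by (simp add: inner_sgn le_divide_eq)
    also have "\<dots> = c - \<eta>1" using qQ nQ by (simp add: p_def inner_diff_right norm_eq_1 inner_commute)
    finally have "c * norm p \<le> c - \<eta>1" .
    moreover have "c * (1 - \<eta>1 * c) \<le> c * norm p" using np c by (intro mult_left_mono) auto
    ultimately have "c * (1 - \<eta>1 * c) \<le> c - \<eta>1" by linarith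
    then have "\<eta>1 * 1 \<le> \<eta>1 * c\<^sup>2" by (simp add: algebra_simps power2_eq_square)
    then have "1 \<le> c\<^sup>2" using \<eta>1(1) by simp
    then show False using c by (simp add: abs_square_less_1 flip: not_less)
  qed
  then obtain \<eta>3 where \<eta>3: "\<eta>3 > 0" "\<And>P. P \<in> K \<Longrightarrow> c + \<eta>3 \<le> q \<bullet> P" using uniform_margin[OF cK] by metis
  define \<eta> where "\<eta> = min \<eta>1 (min \<eta>2 \<eta>3)"
  have \<eta>: "0 < \<eta>" "\<eta> \<le> 1" using \<eta>1 \<eta>2 \<eta>3 \<eta>11 by (auto simp: \<eta>_def)
  have m1: "\<eta> \<le> q \<bullet> x" if "x \<in> C" for x using \<eta>1(2)[OF that] by (simp add: \<eta>_def)
  have m2: "0 + \<eta> \<le> P \<bullet> z" if "P \<in> K" for P using \<eta>2(2)[OF that] by (simp add: \<eta>_def inner_commute)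
  have m3: "c + \<eta> \<le> P \<bullet> q" if "P \<in> K" for P using \<eta>3(2)[OF that] by (simp add: \<eta>_def inner_commute)
  \<comment> \<open>A net of mesh \<epsilon> costs a displacement of 2 \<epsilon> / \<eta> = \<eta>
    r / 4. Pushing C into D then has defect \<eta> r / 4 against slack \<eta> / 2, which gives the
    bound r.\<close>
  define \<epsilon> where "\<epsilon> = \<eta>\<^sup>2 * r / 8"
  have \<epsilon>0: "0 < \<epsilon>" using \<eta> r by (simp add: \<epsilon>_def)
  have \<epsilon>\<eta>: "2 * (\<epsilon> / \<eta>) = \<eta> * r / 4" using \<eta> by (simp add: \<epsilon>_def power2_eq_square)
  have \<eta>r: "\<eta> * r < \<eta>" "\<eta> * r \<le> r" using \<eta> r by (simp_all add: mult_left_le_one_le)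
  have "2 * \<epsilon> = \<eta> * (2 * (\<epsilon> / \<eta>))" using \<eta> by simp
  also have "\<dots> \<le> 1 * (\<eta> * r / 4)" unfolding \<epsilon>\<eta> using \<eta> r by (intro mult_right_mono) auto
  finally have \<epsilon>lt: "\<epsilon> < \<eta>" using \<eta>r(1) \<eta> \<epsilon>0 by linarith
  \<comment> \<open>Two distinct centres are put into the net, as
    \<open>reuleaux_polygon_diameter\<close> requires.\<close>
  obtain P1 where P1: "P1 \<in> csupp C" using cw(1) by blast
  then obtain P2 where P2: "P2 \<in> csupp C" "P1 \<bullet> P2 = c" using cw(6) by blast
  have P12: "P1 \<in> K" "P2 \<in> K" using P1 P2 by (auto simp: K_def csupp_def)
  have "P1 \<noteq> P2" using P2(2) c diam_leD(1)[OF dia P12(1)] by (auto simp: norm_eq_1)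
  obtain F0 where F0: "finite F0" "F0 \<subseteq> K" "K \<subseteq> (\<Union>f\<in>F0. ball f \<epsilon>)"
    using seq_compact_imp_totally_bounded[of K] cK \<epsilon>0 unfolding compact_eq_seq_compact_metric by blast
  define F where "F = insert P1 (insert P2 F0)"
  have F: "finite F" "F \<subseteq> K" "K \<subseteq> (\<Union>f\<in>F. ball f \<epsilon>)" using F0 P12 by (auto simp: F_def)
  obtain E where E: "F \<subseteq> E" "finite E" "diam_le c E" "verts c E \<subseteq> E"
    using finite_completion[OF c F(1) diam_le_subset[OF dia F(2)]] by blast
  have P12E: "P1 \<in> E" "P2 \<in> E" using E(1) by (auto simp: F_def)
  define K' where "K' = caps c E"
  define D where "D = caps 0 K'"
  have diaK': "diam_le c K'" unfolding K'_def
    by (rule reuleaux_polygon_diameter[OF c E(2-4) P12E \<open>P1 \<noteq> P2\<close>])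
  have "E \<subseteq> K'" using E(3) by (simp add: K'_def diam_le_def)
  have K'F: "K' \<subseteq> caps c F" unfolding K'_def by (rule caps_antimono[OF E(1)])
  have DF: "D \<subseteq> caps 0 F" unfolding D_def using \<open>E \<subseteq> K'\<close> E(1) by (intro caps_antimono) blast
  have near1: "\<exists>y\<in>C. norm (y - x) \<le> \<eta> * r / 4" if x: "x \<in> D" for x
  proof -
    have "norm x = 1" using x capsD(1) by (auto simp: D_def)
    moreover have "0 - \<epsilon> \<le> P \<bullet> x" if "P \<in> K" for P using net_caps_bound[OF F(3) _ that] x DF by blast
    ultimately obtain y where "y \<in> caps 0 K" "norm (y - x) \<le> 2 * (\<epsilon> / \<eta>)"
      using push_into_caps[of 0 x z \<epsilon> \<eta> K] nz \<epsilon>0 \<epsilon>lt m2 by (metis order_refl less_imp_le)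
    then show ?thesis using polK unfolding \<epsilon>\<eta> by blast
  qed
  have near2: "\<exists>P'\<in>K. norm (P' - P) \<le> \<eta> * r / 4" if P: "P \<in> K'" for P
  proof -
    have "norm P = 1" using P capsD(1) by (auto simp: K'_def)
    moreover have "c - \<epsilon> \<le> Q \<bullet> P" if "Q \<in> K" for Q using net_caps_bound[OF F(3) _ that] P K'F by blast
    ultimately obtain y where "y \<in> caps c K" "norm (y - P) \<le> 2 * (\<epsilon> / \<eta>)"
      using push_into_caps[of c P q \<epsilon> \<eta> K] q(1) \<epsilon>0 \<epsilon>lt m3 c by (metis less_imp_le)
    then show ?thesis using complete unfolding \<epsilon>\<eta> by blast
  qed
  have near3: "\<exists>x\<in>D. norm (x - y) \<le> r" if y: "y \<in> C" for y
  proof -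
    have ny: "norm y = 1" using y CB(2) by auto
    have b: "0 - \<eta> * r / 4 \<le> P \<bullet> y" "0 + \<eta> / 2 \<le> P \<bullet> z" if P: "P \<in> K'" for P
    proof -
      obtain P' where P': "P' \<in> K" "norm (P' - P) \<le> \<eta> * r / 4" using near2[OF P] by blast
      have "0 \<le> P' \<bullet> y" using capsD(2)[OF P'(1)[unfolded K_def] y] by (simp add: inner_commute)
      then show "0 - \<eta> * r / 4 \<le> P \<bullet> y" using inner_perturb[OF ny, of P' P] P'(2) by (simp add: norm_minus_commute)
      show "0 + \<eta> / 2 \<le> P \<bullet> z" using m2[OF P'(1)] inner_perturb[OF nz, of P' P] P'(2) \<eta>r(1) \<eta>(1) norm_minus_commute[of P P']
        by linarith
    qed
    have "0 \<le> \<eta> * r / 4" "\<eta> * r / 4 < \<eta> / 2" using \<eta> r \<eta>r by simp_all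
    then obtain x where "x \<in> caps 0 K'" "norm (x - y) \<le> 2 * ((\<eta> * r / 4) / (\<eta> / 2))"
      using push_into_caps[of 0 y z "\<eta> * r / 4" "\<eta> / 2" K'] ny nz b by (metis order_refl)
    then show ?thesis using \<eta> by (auto simp: D_def)
  qed
  have qD: "q \<bullet> x > 0" if x: "x \<in> D" for x
  proof -
    obtain y where y: "y \<in> C" "norm (y - x) \<le> \<eta> * r / 4" using near1[OF x] by blast
    have "y \<bullet> q - norm (x - y) \<le> x \<bullet> q" by (rule inner_perturb[OF q(1)])
    then show ?thesis using m1[OF y(1)] y(2) \<eta>r(1) \<eta>(1) by (simp only: norm_minus_commute[of x] inner_commute[of _ q])
  qed
  interpret reuleaux_polygon c s E q
  proof
    show "diam_le c (caps c E)" using diaK' by (simp add: K'_def)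
    show "E \<noteq> {}" using P12E by blast
    show "\<And>x. x \<in> caps 0 (caps c E) \<Longrightarrow> 0 < q \<bullet> x" using qD by (simp add: D_def K'_def)
  qed (use c s E q in auto)
  have "\<forall>x\<in>D. \<exists>y\<in>C. norm (x - y) \<le> r"
  proof
    fix x assume "x \<in> D"
    then obtain y where y: "y \<in> C" "norm (y - x) \<le> \<eta> * r / 4" using near1 by blast
    then have "norm (x - y) \<le> r" using \<eta>r(2) r norm_minus_commute[of x y] by linarith
    then show "\<exists>y\<in>C. norm (x - y) \<le> r" using y by blast
  qed
  then show ?thesis
    using D_body D_constant_width D_boundary_of_arcs near3
    unfolding arc_s arc_c K'_def[symmetric] D_def[symmetric] by blast
qed

section \<open>From chords to the Hausdorff distance\<close>

lemma sdist_le: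
  assumes "norm x = 1" "norm y = 1" "norm (x - y) \<le> r" "r \<le> 1"
  shows "sdist x y \<le> arccos (1 - r\<^sup>2 / 2)"
proof -
  have "(norm (x - y))\<^sup>2 = 2 - 2 * (x \<bullet> y)"
    using assms unfolding power2_norm_eq_inner by (simp add: inner_diff_left inner_diff_right norm_eq_1 inner_commute)
  moreover have "(norm (x - y))\<^sup>2 \<le> r\<^sup>2" using assms by (intro power_mono) auto
  moreover have "0 \<le> r" using assms norm_ge_zero order_trans by blast
  then have "r\<^sup>2 \<le> 1" using assms by (simp add: power_le_one)
  ultimately show ?thesis unfolding sdist_def
    using inner_le_1[OF assms(1,2)] by (intro arccos_le_arccos) auto
qed

lemma sdist_bounds:
  assumes "norm x = 1" "norm y = 1" shows "0 \<le> sdist x y" "sdist x y \<le> pi"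
  unfolding sdist_def
  using arccos_lbound arccos_ubound inner_le_1[OF assms] inner_ge_minus_1[OF assms] by auto

lemma SUP_INF_sdist:
  assumes X: "X \<subseteq> S2" "X \<noteq> {}" and Y: "Y \<subseteq> S2" "Y \<noteq> {}"
    and near: "\<And>x. x \<in> X \<Longrightarrow> \<exists>y\<in>Y. sdist x y \<le> a"
  shows "0 \<le> (SUP x\<in>X. INF y\<in>Y. sdist x y)" "(SUP x\<in>X. INF y\<in>Y. sdist x y) \<le> a"
proof -
  have bdd: "bdd_below ((\<lambda>y. sdist x y) ` Y)" if "x \<in> X" for x
    using sdist_bounds(1)[of x] that X(1) Y(1) by (intro bdd_belowI[of _ 0]) (auto simp: subset_iff)
  have le: "(INF y\<in>Y. sdist x y) \<le> a" if x: "x \<in> X" for x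
    using near[OF x] bdd[OF x] by (meson cINF_lower order_trans)
  have ge: "0 \<le> (INF y\<in>Y. sdist x y)" if x: "x \<in> X" for x
    using sdist_bounds(1)[of x] x X(1) Y by (intro cINF_greatest) (auto simp: subset_iff)
  show "(SUP x\<in>X. INF y\<in>Y. sdist x y) \<le> a" using X le by (intro cSUP_least) auto
  obtain x where x: "x \<in> X" using X by auto
  have "bdd_above ((\<lambda>x. INF y\<in>Y. sdist x y) ` X)" using le by (intro bdd_aboveI[of _ a]) auto
  then show "0 \<le> (SUP x\<in>X. INF y\<in>Y. sdist x y)" using ge[OF x] cSUP_upper[OF x] order_trans by blast
qed

lemma hausdorff_sdist_bounds:
  assumes X: "X \<subseteq> S2" "X \<noteq> {}" and Y: "Y \<subseteq> S2" "Y \<noteq> {}" and r: "r \<le> 1"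
    and near: "\<forall>x\<in>X. \<exists>y\<in>Y. norm (x - y) \<le> r" "\<forall>y\<in>Y. \<exists>x\<in>X. norm (x - y) \<le> r"
  shows "0 \<le> hausdorff_sdist X Y" "hausdorff_sdist X Y \<le> arccos (1 - r\<^sup>2 / 2)"
proof -
  have sd: "sdist x y \<le> arccos (1 - r\<^sup>2 / 2)" if "x \<in> X" "y \<in> Y" "norm (x - y) \<le> r" for x y
    using that X Y r by (intro sdist_le) auto
  have sym: "(\<lambda>P. sdist P Q) = sdist Q" for Q by (simp add: sdist_def inner_commute fun_eq_iff)
  have 1: "\<exists>y\<in>Y. sdist x y \<le> arccos (1 - r\<^sup>2 / 2)" if "x \<in> X" for x using near(1) sd that by blast
  have 2: "\<exists>x\<in>X. sdist y x \<le> arccos (1 - r\<^sup>2 / 2)" if "y \<in> Y" for y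
    using near(2) sd that by (metis sym)
  show "0 \<le> hausdorff_sdist X Y" "hausdorff_sdist X Y \<le> arccos (1 - r\<^sup>2 / 2)"
    using SUP_INF_sdist[OF X Y 1] SUP_INF_sdist[OF Y X 2] unfolding hausdorff_sdist_def sym by auto
qed

theorem corollary2:
  fixes \<tau> :: real and C :: "(real^3) set"
  assumes "\<tau> > pi / 2"
    and "spherical_convex_body C"
    and "constant_width C \<tau>"
  shows "\<exists>D :: nat \<Rightarrow> (real^3) set.
           (\<forall>i. spherical_convex_body (D i) \<and> constant_width (D i) \<tau> \<and>
                boundary_of_arcs (\<tau> - pi / 2) (D i)) \<and>
           (\<lambda>i. hausdorff_sdist (D i) C) \<longlonglongrightarrow> 0"
proof -
  \<comment> \<open>The shift by two keeps the first radius strictly below 1.\<close>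
  define r where "r i = inverse (real (Suc (Suc i)))" for i
  have r: "0 < r i" "r i < 1" for i by (auto simp: r_def inverse_less_1_iff)
  obtain D where D: "\<And>i. spherical_convex_body (D i)" "\<And>i. constant_width (D i) \<tau>"
      "\<And>i. boundary_of_arcs (\<tau> - pi / 2) (D i)"
      "\<And>i. \<forall>x\<in>D i. \<exists>y\<in>C. norm (x - y) \<le> r i" "\<And>i. \<forall>y\<in>C. \<exists>x\<in>D i. norm (x - y) \<le> r i"
    using reuleaux_approximation[OF assms r] by metis
  have "r \<longlonglongrightarrow> 0" unfolding r_def by (rule LIMSEQ_Suc[OF LIMSEQ_inverse_real_of_nat])
  then have "(\<lambda>i. 1 - (r i)\<^sup>2 / 2) \<longlonglongrightarrow> 1 - 0\<^sup>2 / 2" by (intro tendsto_intros) auto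
  then have "(\<lambda>i. arccos (1 - (r i)\<^sup>2 / 2)) \<longlonglongrightarrow> arccos (1 - 0\<^sup>2 / 2)"
  proof (rule continuous_on_tendsto_compose[OF continuous_on_arccos'])
    have "(r i)\<^sup>2 \<le> 1" for i using r[of i] by (simp add: power_le_one less_imp_le)
    then show "\<forall>\<^sub>F i in sequentially. 1 - (r i)\<^sup>2 / 2 \<in> {-1..1}"
      by (intro always_eventually allI) (simp add: order_trans[of _ 1 4])
  qed simp
  then have lim: "(\<lambda>i. arccos (1 - (r i)\<^sup>2 / 2)) \<longlonglongrightarrow> 0" by simp
  have b: "0 \<le> hausdorff_sdist (D i) C" "hausdorff_sdist (D i) C \<le> arccos (1 - (r i)\<^sup>2 / 2)" for i
    using hausdorff_sdist_bounds[OF spherical_convex_bodyD(2,3)[OF D(1)] spherical_convex_bodyD(2,3)[OF assms(2)] _ D(4,5)]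
      r(2)[of i] by (simp_all add: less_imp_le)
  have "(\<lambda>i. hausdorff_sdist (D i) C) \<longlonglongrightarrow> 0"
    by (rule tendsto_sandwich[OF _ _ tendsto_const lim]) (use b in auto)
  then show ?thesis using D(1-3) by blast
qed

end
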